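(* Let $\mathcal{B}$ be a complete Boolean algebra, let $Q$ be the Stone space of $\mathcal{B}$ and let $\mathbb{X}$ be an ideal in $\mathbb{C}(Q)$. The following conditions are equivalent: (i) The Boolean algebra $s(\mathbb{X})\mathcal{B}$ is $\sigma$-distributive. (ii) Every band preserving derivation from $\mathbb{X}$ into $L^0_{\mathbb{C}}(\mathcal{B})$ is trivial (identically zero).
   Context: $L^0(\mathcal{B}):=C_\infty(Q)$ denotes the set of all continuous functions $x:Q\to[-\infty,+\infty]$ taking the values $\pm\infty$ at most on a nowhere dense set; with the usual operations (pointwise on a dense open set, extended by continuity) and pointwise order it is a commutative real algebra and a universally complete vector lattice. $L^0_{\mathbb{C}}(\mathcal{B})=L^0(\mathcal{B})\oplus iL^0(\mathcal{B})$ is its complexification, a commutative complex $*$-algebra with $\overline{x+iy}=x-iy$ and modulus $|z|=(\overline{z}z)^{1/2}\in L^0(\mathcal{B})$. $\mathbb{C}(Q)\subset L^0_{\mathbb{C}}(\mathcal{B})$ is the algebra of continuous complex-valued functions on $Q$. $\mathcal{B}$ is identified with the Boolean algebra of idempotents of $L^0(\mathcal{B})$ (characteristic functions of clopen sets); $\mathbf{1}$ is the constant function one. For $e\in\mathcal{B}$, $e\mathcal{B}=\{q\in\mathcal{B}:q\leqslant e\}$, a Boolean algebra with unit $e$ (the one-element algebra, trivially $\sigma$-distributive, if $e=\mathbf 0$). A $\sigma$-complete Boolean algebra is $\sigma$-distributive if $\bigvee_{n}\bigwedge_{m}e_{n,m}=\bigwedge_{\varphi\in\mathbb{N}^{\mathbb{N}}}\bigvee_{n}e_{n,\varphi(n)}$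 for every double sequence $\{e_{n,m}\}_{n,m\in\mathbb{N}}$ in it. Support: for $z\in L^0_{\mathbb{C}}(\mathcal{B})$, $s(z)=s(|z|)=\mathbf{1}-\sup\{e\in\mathcal{B}:e|z|=0\}\in\mathcal{B}$; for non-empty $E$, $s(E)=\sup\{s(z):z\in E\}$. An ideal in $\mathbb{C}(Q)$ is a complex subalgebra $\mathbb{X}\subset\mathbb{C}(Q)$ with $xa\in\mathbb{X}$ for all $x\in\mathbb{C}(Q)$, $a\in\mathbb{X}$. A derivation $\delta:\mathbb{X}\to L^0_{\mathbb{C}}(\mathcal{B})$ is a complex-linear map with $\delta(xy)=\delta(x)y+x\delta(y)$ for all $x,y\in\mathbb{X}$; it is band preserving if $s(\delta(x))\leqslant s(x)$ for all $x\in\mathbb{X}$. *)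

theory Defs
  imports "HOL-Analysis.Analysis"
begin

text \<open>
  Complete Boolean algebras are types of sort \<open>{boolean_algebra, complete_lattice}\<close>. The library
  class \<open>complete_boolean_algebra\<close> is not used: it includes complete distributivity, so
  all its instances are atomic.
\<close>

section \<open>The Stone space\<close>

definition ultrafilter_on_algebra :: "'b::boolean_algebra set \<Rightarrow> bool" where
  "ultrafilter_on_algebra U \<longleftrightarrow>
     top \<in> U \<and> bot \<notin> U \<and>
     (\<forall>a\<in>U. \<forall>b\<in>U. inf a b \<in> U) \<and>
     (\<forall>a\<in>U. \<forall>b. a \<le> b \<longrightarrow> b \<in> U) \<and>
     (\<forall>a. a \<in> U \<or> - a \<in> U)"

definition stone_clopen :: "'b::boolean_algebra \<Rightarrow> 'b set set" where
  "stone_clopen a = {U. ultrafilter_on_algebra U \<and> a \<in> U}"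

definition stone_space :: "'b::boolean_algebra set topology" where
  "stone_space = topology_generated_by (range stone_clopen)"

lemma topspace_stone_space: "topspace stone_space = {U. ultrafilter_on_algebra U}"
  by (auto simp: stone_space_def stone_clopen_def ultrafilter_on_algebra_def)


section \<open>The algebra \<open>C\<^sub>\<infinity>(Q)\<close>\<close>

text \<open>Functions on the carrier of a topology are made \<open>extensional\<close>, so that equality of functions
  is equality on the carrier.\<close>

definition C_inf :: "'a topology \<Rightarrow> ('a \<Rightarrow> ereal) set" where
  "C_inf Q = {x \<in> extensional (topspace Q).
     continuous_map Q euclidean x \<and>
     Q interior_of (Q closure_of {q \<in> topspace Q. \<bar>x q\<bar> = \<infinity>}) = {}}"

definition finite_part :: "'a topology \<Rightarrow> ('a \<Rightarrow> ereal) \<Rightarrow> 'a set" where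
  "finite_part Q x = {q \<in> topspace Q. \<bar>x q\<bar> \<noteq> \<infinity>}"

text \<open>The extension by continuity of \<open>f\<close> from a dense open set \<open>D\<close>. Uniqueness holds for dense \<open>D\<close>;
  existence, for \<open>f\<close> continuous and finite on \<open>D\<close>, uses that \<open>Q\<close> is extremally disconnected, as the
  Stone space of a complete algebra is.\<close>

definition cont_ext :: "'a topology \<Rightarrow> 'a set \<Rightarrow> ('a \<Rightarrow> ereal) \<Rightarrow> 'a \<Rightarrow> ereal" where
  "cont_ext Q D f = (THE z. z \<in> C_inf Q \<and> (\<forall>q\<in>D. z q = f q))"

definition L0_add :: "'a topology \<Rightarrow> ('a \<Rightarrow> ereal) \<Rightarrow> ('a \<Rightarrow> ereal) \<Rightarrow> 'a \<Rightarrow> ereal" where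
  "L0_add Q x y = cont_ext Q (finite_part Q x \<inter> finite_part Q y) (\<lambda>q. x q + y q)"

definition L0_diff :: "'a topology \<Rightarrow> ('a \<Rightarrow> ereal) \<Rightarrow> ('a \<Rightarrow> ereal) \<Rightarrow> 'a \<Rightarrow> ereal" where
  "L0_diff Q x y = cont_ext Q (finite_part Q x \<inter> finite_part Q y) (\<lambda>q. x q - y q)"

definition L0_mult :: "'a topology \<Rightarrow> ('a \<Rightarrow> ereal) \<Rightarrow> ('a \<Rightarrow> ereal) \<Rightarrow> 'a \<Rightarrow> ereal" where
  "L0_mult Q x y = cont_ext Q (finite_part Q x \<inter> finite_part Q y) (\<lambda>q. x q * y q)"

definition L0_scale :: "'a topology \<Rightarrow> real \<Rightarrow> ('a \<Rightarrow> ereal) \<Rightarrow> 'a \<Rightarrow> ereal" where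
  "L0_scale Q c x = cont_ext Q (finite_part Q x) (\<lambda>q. ereal c * x q)"

definition L0_zero :: "'a topology \<Rightarrow> 'a \<Rightarrow> ereal" where
  "L0_zero Q = restrict (\<lambda>_. 0) (topspace Q)"


section \<open>Its complexification\<close>

text \<open>The pair \<open>(x, y)\<close> stands for \<open>x + iy\<close>.\<close>

type_synonym 'a L0C = "('a \<Rightarrow> ereal) \<times> ('a \<Rightarrow> ereal)"

definition L0C :: "'a topology \<Rightarrow> 'a L0C set" where
  "L0C Q = C_inf Q \<times> C_inf Q"

definition L0C_zero :: "'a topology \<Rightarrow> 'a L0C" where
  "L0C_zero Q = (L0_zero Q, L0_zero Q)"

definition L0C_add :: "'a topology \<Rightarrow> 'a L0C \<Rightarrow> 'a L0C \<Rightarrow> 'a L0C" where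
  "L0C_add Q z w = (L0_add Q (fst z) (fst w), L0_add Q (snd z) (snd w))"

definition L0C_mult :: "'a topology \<Rightarrow> 'a L0C \<Rightarrow> 'a L0C \<Rightarrow> 'a L0C" where
  "L0C_mult Q z w =
     (L0_diff Q (L0_mult Q (fst z) (fst w)) (L0_mult Q (snd z) (snd w)),
      L0_add Q (L0_mult Q (fst z) (snd w)) (L0_mult Q (snd z) (fst w)))"

definition L0C_scale :: "'a topology \<Rightarrow> complex \<Rightarrow> 'a L0C \<Rightarrow> 'a L0C" where
  "L0C_scale Q c z =
     (L0_diff Q (L0_scale Q (Re c) (fst z)) (L0_scale Q (Im c) (snd z)),
      L0_add Q (L0_scale Q (Re c) (snd z)) (L0_scale Q (Im c) (fst z)))"

definition L0C_cnj :: "'a topology \<Rightarrow> 'a L0C \<Rightarrow> 'a L0C" where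
  "L0C_cnj Q z = (fst z, L0_scale Q (- 1) (snd z))"

text \<open>The modulus is the non-negative square root of \<open>cnj z * z\<close> in the real part.\<close>

definition L0C_mod :: "'a topology \<Rightarrow> 'a L0C \<Rightarrow> 'a \<Rightarrow> ereal" where
  "L0C_mod Q z =
     (THE r. r \<in> C_inf Q \<and> (\<forall>q\<in>topspace Q. 0 \<le> r q) \<and>
             (L0_mult Q r r, L0_zero Q) = L0C_mult Q (L0C_cnj Q z) z)"

text \<open>The continuous complex-valued functions, as a subset of the complexification.\<close>

definition CC_embed :: "'a topology \<Rightarrow> ('a \<Rightarrow> complex) \<Rightarrow> 'a L0C" where
  "CC_embed Q g =
     (restrict (\<lambda>q. ereal (Re (g q))) (topspace Q), restrict (\<lambda>q. ereal (Im (g q))) (topspace Q))"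

definition CC :: "'a topology \<Rightarrow> 'a L0C set" where
  "CC Q = CC_embed Q ` {g. continuous_map Q euclidean g}"


section \<open>Supports\<close>

definition idem :: "'b::boolean_algebra \<Rightarrow> 'b set \<Rightarrow> ereal" where
  "idem e = restrict (indicator (stone_clopen e)) (topspace stone_space)"

definition supp :: "'b::{boolean_algebra,complete_lattice} set L0C \<Rightarrow> 'b" where
  "supp z = - Sup {e. L0_mult stone_space (idem e) (L0C_mod stone_space z) = L0_zero stone_space}"

definition supp_set :: "'b::{boolean_algebra,complete_lattice} set L0C set \<Rightarrow> 'b" where
  "supp_set E = Sup (supp ` E)"


section \<open>\<open>\<sigma>\<close>-distributivity\<close>

text \<open>\<open>\<sigma>\<close>-distributivity of the algebra \<open>{q. q \<le> e}\<close> with unit \<open>e\<close>. Only non-empty families occur,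
  so their suprema and infima in that algebra are those of the ambient one.\<close>

definition sigma_distributive_below :: "'b::{boolean_algebra,complete_lattice} \<Rightarrow> bool" where
  "sigma_distributive_below e \<longleftrightarrow>
     (\<forall>E :: nat \<Rightarrow> nat \<Rightarrow> 'b. (\<forall>n m. E n m \<le> e) \<longrightarrow>
        (SUP n. INF m. E n m) = (INF \<phi>. SUP n. E n (\<phi> n)))"


section \<open>Ideals and derivations\<close>

definition CC_ideal :: "'a topology \<Rightarrow> 'a L0C set \<Rightarrow> bool" where
  "CC_ideal Q X \<longleftrightarrow>
     X \<subseteq> CC Q \<and> L0C_zero Q \<in> X \<and>
     (\<forall>a\<in>X. \<forall>b\<in>X. L0C_add Q a b \<in> X) \<and>
     (\<forall>c. \<forall>a\<in>X. L0C_scale Q c a \<in> X) \<and>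
     (\<forall>a\<in>X. \<forall>b\<in>X. L0C_mult Q a b \<in> X) \<and>
     (\<forall>x\<in>CC Q. \<forall>a\<in>X. L0C_mult Q x a \<in> X)"

definition derivation :: "'a topology \<Rightarrow> 'a L0C set \<Rightarrow> ('a L0C \<Rightarrow> 'a L0C) \<Rightarrow> bool" where
  "derivation Q X \<delta> \<longleftrightarrow>
     \<delta> \<in> X \<rightarrow> L0C Q \<and>
     (\<forall>x\<in>X. \<forall>y\<in>X. \<delta> (L0C_add Q x y) = L0C_add Q (\<delta> x) (\<delta> y)) \<and>
     (\<forall>c. \<forall>x\<in>X. \<delta> (L0C_scale Q c x) = L0C_scale Q c (\<delta> x)) \<and>
     (\<forall>x\<in>X. \<forall>y\<in>X.
        \<delta> (L0C_mult Q x y) = L0C_add Q (L0C_mult Q (\<delta> x) y) (L0C_mult Q x (\<delta> y)))"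

definition band_preserving ::
  "'b::{boolean_algebra,complete_lattice} set L0C set \<Rightarrow> ('b set L0C \<Rightarrow> 'b set L0C) \<Rightarrow> bool" where
  "band_preserving X \<delta> \<longleftrightarrow> (\<forall>x\<in>X. supp (\<delta> x) \<le> supp x)"

end

theory Submission
  imports Defs "HOL-Computational_Algebra.Polynomial"
begin

text \<open>
  A function in \<open>C\<^sub>\<infinity>(Q)\<close> is determined by its finite values on any dense open set, and on the Stone
  space of a complete algebra every real function that is continuous on a dense open set extends. Hence
  \<open>L0C Q\<close> is the ring of complex functions continuous on a dense open set, modulo equality on a dense open
  set. Such a function has, after shrinking any given open set, either no zero or only zeros; so the ring
  can be handled locally as if it were a field, and identities can be checked point by point.

  The link with \<open>\<sigma>\<close>-distributivity is that the law holds below \<open>s\<close> exactly if every continuous function is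
  constant on some nonzero \<open>e\<close> below any given nonzero \<open>f \<le> s\<close>. The law makes it possible to decide all
  comparisons with rational numbers at once (\<open>sigma_distributive_locally_constant\<close>). Conversely, if it
  fails for a double sequence, a series with ternary weights that codes membership in all its entries is
  constant on no nonzero element of a suitable \<open>{e. e \<le> f}\<close> (\<open>non_sigma_distributive_nowhere_constant\<close>).

  If continuous functions are locally constant, then an element \<open>x\<close> of the ideal agrees on small clopen
  sets with a multiple \<open>c u\<close> of an idempotent \<open>u\<close> of the ideal. A derivation kills \<open>u\<close>, and a band
  preserving one sends \<open>x - c u\<close> to something that vanishes on the same set; so it is zero
  (\<open>band_preserving_derivation_zero\<close>).

  If \<open>g\<close> is nowhere constant below \<open>f\<close>, then \<open>g\<close> is transcendental over the complex numbers there, and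
  differentiation with respect to \<open>g\<close> is a well-defined derivation on the polynomials in \<open>g\<close>. It extends to
  the whole ring as derivations of fields of characteristic zero do, one element \<open>x\<close> at a time
  (\<open>local_derivation_extends\<close>): where \<open>x\<close> is a simple root of a polynomial over the algebra reached so far,
  its derivative is forced, elsewhere it may be zero, and the pieces glue because continuous functions on
  open sets do. The extension is local by construction, therefore band preserving, and its value at \<open>g\<close>
  is one on \<open>f\<close> (\<open>nonzero_derivation_exists\<close>).
\<close>

section \<open>Properties that hold on a dense open set\<close>

definition dense_open :: "'a topology \<Rightarrow> 'a set \<Rightarrow> bool" where
  "dense_open Q D \<longleftrightarrow> openin Q D \<and> (\<forall>U. openin Q U \<longrightarrow> U \<noteq> {} \<longrightarrow> U \<inter> D \<noteq> {})"

text \<open>Equality in \<open>C\<^sub>\<infinity>(Q)\<close> amounts to equality of values eventually along this filter. As a filter it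
  lets finitely many such equalities be combined without naming the dense open sets.\<close>

definition generic :: "'a topology \<Rightarrow> 'a filter" where
  "generic Q = (INF D\<in>Collect (dense_open Q). principal D)"

lemma dense_openD: "dense_open Q D \<Longrightarrow> openin Q U \<Longrightarrow> U \<inter> D = {} \<Longrightarrow> U = {}"
  unfolding dense_open_def by blast

lemma dense_open_topspace: "dense_open Q (topspace Q)"
  using openin_subset unfolding dense_open_def by fastforce

lemma dense_open_Int: "dense_open Q D \<Longrightarrow> dense_open Q D' \<Longrightarrow> dense_open Q (D \<inter> D')"
  unfolding dense_open_def by (metis Int_assoc openin_Int)

lemma eventually_generic:
  "eventually P (generic Q) \<longleftrightarrow> (\<exists>D. dense_open Q D \<and> (\<forall>q\<in>D. P q))"
proof -
  have "eventually P (generic Q) \<longleftrightarrow> (\<exists>D\<in>Collect (dense_open Q). eventually P (principal D))"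
    unfolding generic_def
  proof (rule eventually_INF_base)
    show "Collect (dense_open Q) \<noteq> {}" using dense_open_topspace by blast
    show "\<exists>D\<in>Collect (dense_open Q). principal D \<le> inf (principal D1) (principal D2)"
      if "D1 \<in> Collect (dense_open Q)" "D2 \<in> Collect (dense_open Q)" for D1 D2
      using that by (intro bexI[of _ "D1 \<inter> D2"]) (auto intro: dense_open_Int)
  qed
  then show ?thesis by (simp add: eventually_principal)
qed

text \<open>Genericity is a local property: it suffices to find, inside every nonempty open set, a smaller
  one on which \<open>P\<close> holds, because all open sets on which \<open>P\<close> holds have a dense union. Most proofs of
  genericity below shrink a given open set finitely many times in this way.\<close>

lemma eventually_generic_local:
  "eventually P (generic Q) \<longleftrightarrow>
     (\<forall>U. openin Q U \<longrightarrow> U \<noteq> {} \<longrightarrow> (\<exists>V. openin Q V \<and> V \<noteq> {} \<and> V \<subseteq> U \<and> (\<forall>q\<in>V. P q)))"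
proof
  assume "eventually P (generic Q)"
  then obtain D where D: "dense_open Q D" "\<forall>q\<in>D. P q"
    unfolding eventually_generic by blast
  show "\<forall>U. openin Q U \<longrightarrow> U \<noteq> {} \<longrightarrow> (\<exists>V. openin Q V \<and> V \<noteq> {} \<and> V \<subseteq> U \<and> (\<forall>q\<in>V. P q))"
  proof (intro allI impI)
    fix U assume "openin Q U" "U \<noteq> {}"
    then show "\<exists>V. openin Q V \<and> V \<noteq> {} \<and> V \<subseteq> U \<and> (\<forall>q\<in>V. P q)"
      using D unfolding dense_open_def by (intro exI[of _ "U \<inter> D"]) auto
  qed
next
  assume *: "\<forall>U. openin Q U \<longrightarrow> U \<noteq> {} \<longrightarrow> (\<exists>V. openin Q V \<and> V \<noteq> {} \<and> V \<subseteq> U \<and> (\<forall>q\<in>V. P q))"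
  define D where "D = \<Union>{V. openin Q V \<and> (\<forall>q\<in>V. P q)}"
  have "dense_open Q D"
    unfolding dense_open_def
  proof (intro conjI allI impI)
    show "openin Q D" unfolding D_def by blast
    fix U assume "openin Q U" "U \<noteq> {}"
    then obtain V where "openin Q V" "V \<noteq> {}" "V \<subseteq> U" "\<forall>q\<in>V. P q" using * by blast
    then show "U \<inter> D \<noteq> {}" unfolding D_def by blast
  qed
  moreover have "\<forall>q\<in>D. P q" unfolding D_def by blast
  ultimately show "eventually P (generic Q)" unfolding eventually_generic by blast
qed

lemma eventually_generic_obtains:
  assumes "eventually P (generic Q)" "openin Q U" "U \<noteq> {}"
  obtains V where "openin Q V" "V \<noteq> {}" "V \<subseteq> U" "\<forall>q\<in>V. P q"
  using assms unfolding eventually_generic_local by blast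

lemma eventually_generic_topspace: "\<forall>\<^sub>F q in generic Q. q \<in> topspace Q"
  using dense_open_topspace unfolding eventually_generic by blast

lemma eventually_dense_open: "dense_open Q D \<Longrightarrow> \<forall>\<^sub>F q in generic Q. q \<in> D"
  unfolding eventually_generic by blast

section \<open>Generically continuous functions\<close>

abbreviation cont_at :: "'a topology \<Rightarrow> ('a \<Rightarrow> 'c::topological_space) \<Rightarrow> 'a \<Rightarrow> bool" where
  "cont_at Q f q \<equiv> (f \<longlongrightarrow> f q) (nhdsin Q q)"

text \<open>Modulo generic equality these functions form the ring on which everything happens. Pointwise
  continuity makes sums and products instances of the limit rules, and division by a function is
  harmless wherever that function has no zero.\<close>

definition gcont :: "'a topology \<Rightarrow> ('a \<Rightarrow> 'c::topological_space) \<Rightarrow> bool" where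
  "gcont Q f \<longleftrightarrow> (\<forall>\<^sub>F q in generic Q. cont_at Q f q)"

lemma cont_at_iff:
  assumes "q \<in> topspace Q"
  shows "cont_at Q f q \<longleftrightarrow> (\<forall>W. open W \<and> f q \<in> W \<longrightarrow> (\<exists>U. openin Q U \<and> q \<in> U \<and> f ` U \<subseteq> W))"
  using assms by (fastforce simp: tendsto_def eventually_nhdsin)

lemma continuous_map_iff_cont_at:
  "continuous_map Q euclidean f \<longleftrightarrow> (\<forall>q\<in>topspace Q. cont_at Q f q)"
proof
  assume f: "continuous_map Q euclidean f"
  show "\<forall>q\<in>topspace Q. cont_at Q f q"
  proof
    fix q assume q: "q \<in> topspace Q"
    show "cont_at Q f q"
      unfolding cont_at_iff[OF q]
    proof (intro allI impI)
      fix W assume W: "open W \<and> f q \<in> W"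
      then have "openin Q {x \<in> topspace Q. f x \<in> W}"
        using f unfolding continuous_map_def by auto
      then show "\<exists>U. openin Q U \<and> q \<in> U \<and> f ` U \<subseteq> W"
        using W q by (intro exI[of _ "{x \<in> topspace Q. f x \<in> W}"]) auto
    qed
  qed
next
  assume *: "\<forall>q\<in>topspace Q. cont_at Q f q"
  show "continuous_map Q euclidean f"
    unfolding continuous_map_def
  proof (intro conjI allI impI)
    show "f \<in> topspace Q \<rightarrow> topspace euclidean" by simp
    fix W :: "'b set" assume "openin euclidean W"
    then have W: "open W" by simp
    show "openin Q {x \<in> topspace Q. f x \<in> W}"
    proof (subst openin_subopen, intro ballI)
      fix q assume q: "q \<in> {x \<in> topspace Q. f x \<in> W}"
      then obtain U where "openin Q U" "q \<in> U" "f ` U \<subseteq> W"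
        using * W cont_at_iff[of q Q f] by auto
      moreover have "U \<subseteq> topspace Q" using \<open>openin Q U\<close> by (rule openin_subset)
      ultimately show "\<exists>T. openin Q T \<and> q \<in> T \<and> T \<subseteq> {x \<in> topspace Q. f x \<in> W}"
        by (intro exI[of _ U]) auto
    qed
  qed
qed

lemma cont_at_cong_open:
  assumes "openin Q V" "q \<in> V" "\<And>p. p \<in> V \<Longrightarrow> f p = h p"
  shows "cont_at Q f q \<longleftrightarrow> cont_at Q h q"
proof -
  have "q \<in> topspace Q" using assms openin_subset by blast
  then have "\<forall>\<^sub>F p in nhdsin Q q. f p = h p"
    using assms unfolding eventually_nhdsin by blast
  then show ?thesis using assms tendsto_cong[of f h] by auto
qed

lemma gcont_continuous_map: "continuous_map Q euclidean f \<Longrightarrow> gcont Q f"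
  unfolding gcont_def continuous_map_iff_cont_at
  using eventually_generic_topspace by (rule eventually_mono) blast

lemma gcont_const [simp, intro]: "gcont Q (\<lambda>_. c)"
  unfolding gcont_def by simp

lemma gcont_indicator:
  fixes V :: "'a set"
  assumes "openin Q V"
  shows "gcont Q (indicator V :: 'a \<Rightarrow> 'c::{topological_space,zero_neq_one})"
  unfolding gcont_def eventually_generic_local
proof (intro allI impI)
  fix U assume U: "openin Q U" "U \<noteq> {}"
  define W where "W = (if U \<inter> V = {} then U else U \<inter> V)"
  have W: "openin Q W" "W \<noteq> {}" "W \<subseteq> U" using U assms unfolding W_def by auto
  have "cont_at Q (indicator V :: 'a \<Rightarrow> 'c) q" if "q \<in> W" for q
  proof -
    have "(indicator V p :: 'c) = indicator V q" if "p \<in> W" for p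
      using that \<open>q \<in> W\<close> unfolding W_def by (auto simp: indicator_def split: if_splits)
    then have "cont_at Q (indicator V :: 'a \<Rightarrow> 'c) q \<longleftrightarrow> cont_at Q (\<lambda>_. indicator V q :: 'c) q"
      by (rule cont_at_cong_open[OF W(1) \<open>q \<in> W\<close>])
    then show ?thesis by simp
  qed
  then show "\<exists>W. openin Q W \<and> W \<noteq> {} \<and> W \<subseteq> U \<and> (\<forall>q\<in>W. cont_at Q (indicator V :: 'a \<Rightarrow> 'c) q)"
    using W by blast
qed

lemma gcont_add:
  fixes f h :: "'a \<Rightarrow> 'c::real_normed_algebra"
  shows "gcont Q f \<Longrightarrow> gcont Q h \<Longrightarrow> gcont Q (\<lambda>q. f q + h q)"
  unfolding gcont_def by (erule (1) eventually_elim2) (rule tendsto_add)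

lemma gcont_mult:
  fixes f h :: "'a \<Rightarrow> 'c::real_normed_algebra"
  shows "gcont Q f \<Longrightarrow> gcont Q h \<Longrightarrow> gcont Q (\<lambda>q. f q * h q)"
  unfolding gcont_def by (erule (1) eventually_elim2) (rule tendsto_mult)

lemma gcont_sum:
  fixes f :: "'i \<Rightarrow> 'a \<Rightarrow> 'c::real_normed_algebra"
  shows "(\<And>i. i \<in> I \<Longrightarrow> gcont Q (f i)) \<Longrightarrow> gcont Q (\<lambda>q. \<Sum>i\<in>I. f i q)"
  by (induction I rule: infinite_finite_induct) (auto intro: gcont_add)

lemma gcont_power:
  fixes f :: "'a \<Rightarrow> complex"
  shows "gcont Q f \<Longrightarrow> gcont Q (\<lambda>q. f q ^ n)"
  unfolding gcont_def by (erule eventually_mono) (rule tendsto_power)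

lemma gcont_continuous_compose:
  fixes k :: "'c::topological_space \<Rightarrow> 'd::topological_space"
  assumes "gcont Q f" "continuous_on UNIV k"
  shows "gcont Q (\<lambda>q. k (f q))"
  using assms(1) unfolding gcont_def
proof (rule eventually_mono)
  fix q assume "cont_at Q f q"
  then show "cont_at Q (\<lambda>q. k (f q)) q"
    using assms(2) continuous_on_tendsto_compose[of UNIV k f "f q" "nhdsin Q q"] by auto
qed

lemma cont_at_nonzero:
  fixes f :: "'a \<Rightarrow> 'c::{t1_space,zero}"
  assumes "cont_at Q f q" "f q \<noteq> 0" "q \<in> topspace Q"
  shows "\<exists>U. openin Q U \<and> q \<in> U \<and> (\<forall>p\<in>U. f p \<noteq> 0)"
proof -
  have "open (- {0::'c})" by auto
  then obtain U where "openin Q U" "q \<in> U" "f ` U \<subseteq> - {0}"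
    using assms cont_at_iff[of q Q f] by blast
  then show ?thesis by (intro exI[of _ U]) auto
qed

text \<open>This dichotomy is what lets the arguments below treat a generically continuous function, after
  shrinking the open set, as an element of a field.\<close>

lemma gcont_zero_or_nonzero:
  fixes f :: "'a \<Rightarrow> 'c::{t1_space,zero}"
  assumes f: "gcont Q f" and U: "openin Q U" "U \<noteq> {}"
  obtains V where "openin Q V" "V \<noteq> {}" "V \<subseteq> U" "\<forall>q\<in>V. cont_at Q f q"
    "(\<forall>q\<in>V. f q = 0) \<or> (\<forall>q\<in>V. f q \<noteq> 0)"
proof -
  obtain V where V: "openin Q V" "V \<noteq> {}" "V \<subseteq> U" "\<forall>q\<in>V. cont_at Q f q"
    using f[unfolded gcont_def] U by (rule eventually_generic_obtains)
  show ?thesis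
  proof (cases "\<forall>q\<in>V. f q = 0")
    case True
    then show ?thesis by (intro that[OF V]) auto
  next
    case False
    then obtain q where q: "q \<in> V" "f q \<noteq> 0" by blast
    then have "q \<in> topspace Q" using V openin_subset by blast
    then obtain W where W: "openin Q W" "q \<in> W" "\<forall>p\<in>W. f p \<noteq> 0"
      using cont_at_nonzero[of f q Q] q V(4) by blast
    have "openin Q (V \<inter> W)" "V \<inter> W \<noteq> {}" "V \<inter> W \<subseteq> U" using V W(1,2) q(1) by auto
    moreover have "\<forall>p\<in>V \<inter> W. cont_at Q f p" using V(4) by blast
    moreover have "(\<forall>p\<in>V \<inter> W. f p = 0) \<or> (\<forall>p\<in>V \<inter> W. f p \<noteq> 0)" using W(3) by blast
    ultimately show ?thesis by (rule that)
  qed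
qed

lemma cont_at_eq_if_generic_eq:
  fixes f h :: "'a \<Rightarrow> 'c::t2_space"
  assumes V: "openin Q V" and ev: "\<forall>\<^sub>F q in generic Q. q \<in> V \<longrightarrow> f q = h q"
    and c: "\<And>q. q \<in> V \<Longrightarrow> cont_at Q f q" "\<And>q. q \<in> V \<Longrightarrow> cont_at Q h q" and q: "q \<in> V"
  shows "f q = h q"
proof (rule ccontr)
  assume "f q \<noteq> h q"
  then obtain A B where AB: "open A" "open B" "f q \<in> A" "h q \<in> B" "A \<inter> B = {}"
    using hausdorff[OF \<open>f q \<noteq> h q\<close>] by blast
  have qt: "q \<in> topspace Q" using V q openin_subset by blast
  obtain U where U: "openin Q U" "q \<in> U" "f ` U \<subseteq> A"
    using c(1)[OF q, unfolded cont_at_iff[OF qt], rule_format, of A] AB by blast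
  obtain U' where U': "openin Q U'" "q \<in> U'" "h ` U' \<subseteq> B"
    using c(2)[OF q, unfolded cont_at_iff[OF qt], rule_format, of B] AB by blast
  have "openin Q (V \<inter> (U \<inter> U'))" "V \<inter> (U \<inter> U') \<noteq> {}" using U U' q V by auto
  with ev obtain W where "W \<noteq> {}" "W \<subseteq> V \<inter> (U \<inter> U')" "\<forall>p\<in>W. p \<in> V \<longrightarrow> f p = h p"
    by (rule eventually_generic_obtains)
  then obtain p where "p \<in> U" "p \<in> U'" "f p = h p" by blast
  then show False using U(3) U'(3) AB(5) by fastforce
qed

text \<open>The open sets in \<open>F\<close> may leave a part of the space uncovered. There the glued function is zero; it
  is continuous on the union of the sets and on the complement of its closure, and these two open
  sets together are dense.\<close>

lemma gcont_glue:
  fixes F :: "('a set \<times> ('a \<Rightarrow> 'c::{topological_space,zero})) set"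
  assumes op: "\<And>V h. (V, h) \<in> F \<Longrightarrow> openin Q V"
    and c: "\<And>V h q. (V, h) \<in> F \<Longrightarrow> q \<in> V \<Longrightarrow> cont_at Q h q"
    and agree: "\<And>V h V' h' q. (V, h) \<in> F \<Longrightarrow> (V', h') \<in> F \<Longrightarrow> q \<in> V \<Longrightarrow> q \<in> V' \<Longrightarrow> h q = h' q"
  shows "\<exists>y. gcont Q y \<and> (\<forall>(V, h)\<in>F. \<forall>q\<in>V. y q = h q)"
proof -
  define y where "y q = (if \<exists>V h. (V, h) \<in> F \<and> q \<in> V then (SOME a. \<exists>V h. (V, h) \<in> F \<and> q \<in> V \<and> a = h q) else 0)" for q
  have y: "y q = h q" if "(V, h) \<in> F" "q \<in> V" for V h q
  proof -
    have "\<exists>a V h. (V, h) \<in> F \<and> q \<in> V \<and> a = h q" using that by blast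
    then have "\<exists>V h. (V, h) \<in> F \<and> q \<in> V \<and> (SOME a. \<exists>V h. (V, h) \<in> F \<and> q \<in> V \<and> a = h q) = h q"
      by (rule someI_ex)
    then have "\<exists>V h. (V, h) \<in> F \<and> q \<in> V \<and> y q = h q" using that unfolding y_def by auto
    then show ?thesis using agree that by metis
  qed
  have "gcont Q y"
    unfolding gcont_def eventually_generic_local
  proof (intro allI impI)
    fix U assume U: "openin Q U" "U \<noteq> {}"
    show "\<exists>W. openin Q W \<and> W \<noteq> {} \<and> W \<subseteq> U \<and> (\<forall>q\<in>W. cont_at Q y q)"
    proof (cases "\<exists>V h. (V, h) \<in> F \<and> U \<inter> V \<noteq> {}")
      case True
      then obtain V h where V: "(V, h) \<in> F" "U \<inter> V \<noteq> {}" by blast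
      have "cont_at Q y q" if "q \<in> U \<inter> V" for q
        using that c[OF V(1)] y[OF V(1)] op[OF V(1)] cont_at_cong_open[of Q V q y h] by blast
      then show ?thesis using U V op by (intro exI[of _ "U \<inter> V"]) auto
    next
      case False
      then have "y q = 0" if "q \<in> U" for q using that unfolding y_def by auto
      then have "cont_at Q y q" if "q \<in> U" for q
        using that U cont_at_cong_open[of Q U q y "\<lambda>_. 0"] by auto
      then show ?thesis using U by blast
    qed
  qed
  then show ?thesis using y by blast
qed

section \<open>Local derivations and their extension\<close>

text \<open>The graph of a derivation whose domain is a complex algebra of generically continuous functions.
  The condition that \<open>v\<close> vanishes at generic zeros of \<open>u\<close> does two things at once. It makes the graph
  single-valued modulo generic equality, and it lets one restrict the derivation to any open set
  without multiplying by indicator functions.\<close>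

definition local_derivation :: "'a topology \<Rightarrow> (('a \<Rightarrow> complex) \<times> ('a \<Rightarrow> complex)) set \<Rightarrow> bool" where
  "local_derivation Q M \<longleftrightarrow>
     (\<forall>(u, v)\<in>M. gcont Q u \<and> gcont Q v \<and> (\<forall>\<^sub>F q in generic Q. u q = 0 \<longrightarrow> v q = 0)) \<and>
     (\<forall>c. (\<lambda>_. c, \<lambda>_. 0) \<in> M) \<and>
     (\<forall>(u, v)\<in>M. \<forall>(u', v')\<in>M. (\<lambda>q. u q + u' q, \<lambda>q. v q + v' q) \<in> M) \<and>
     (\<forall>(u, v)\<in>M. \<forall>(u', v')\<in>M. (\<lambda>q. u q * u' q, \<lambda>q. u q * v' q + v q * u' q) \<in> M)"

lemma local_derivationD:
  assumes "local_derivation Q M"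
  shows "(u, v) \<in> M \<Longrightarrow> gcont Q u" "(u, v) \<in> M \<Longrightarrow> gcont Q v"
    "(u, v) \<in> M \<Longrightarrow> \<forall>\<^sub>F q in generic Q. u q = 0 \<longrightarrow> v q = 0"
    "(\<lambda>_. c, \<lambda>_. 0) \<in> M"
    "(u, v) \<in> M \<Longrightarrow> (u', v') \<in> M \<Longrightarrow> (\<lambda>q. u q + u' q, \<lambda>q. v q + v' q) \<in> M"
    "(u, v) \<in> M \<Longrightarrow> (u', v') \<in> M \<Longrightarrow> (\<lambda>q. u q * u' q, \<lambda>q. u q * v' q + v q * u' q) \<in> M"
  using assms unfolding local_derivation_def by blast+

lemma local_derivation_cmult:
  assumes "local_derivation Q M" "(u, v) \<in> M"
  shows "(\<lambda>q. c * u q, \<lambda>q. c * v q) \<in> M"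
  using local_derivationD(6)[OF assms(1) local_derivationD(4)[OF assms(1), of c] assms(2)] by simp

lemma local_derivation_diff:
  assumes "local_derivation Q M" "(u, v) \<in> M" "(u', v') \<in> M"
  shows "(\<lambda>q. u q - u' q, \<lambda>q. v q - v' q) \<in> M"
  using local_derivationD(5)[OF assms(1,2) local_derivation_cmult[OF assms(1,3), of "-1"]] by simp

lemma local_derivation_sum:
  assumes "local_derivation Q M" "\<And>i. i \<in> I \<Longrightarrow> (u i, v i) \<in> M"
  shows "(\<lambda>q. \<Sum>i\<in>I. u i q, \<lambda>q. \<Sum>i\<in>I. v i q) \<in> M"
  using assms(2)
  by (induction I rule: infinite_finite_induct)
    (auto intro: local_derivationD(4)[OF assms(1), of 0] local_derivationD(5)[OF assms(1)])

text \<open>A polynomial over the algebra is kept as a pointwise family of complex polynomials of bounded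
  degree, so that identities between polynomials can be checked at single points. The second
  component carries the derivatives of the coefficients.\<close>

definition poly_pairs ::
  "(('a \<Rightarrow> complex) \<times> ('a \<Rightarrow> complex)) set \<Rightarrow> nat \<Rightarrow> (('a \<Rightarrow> complex poly) \<times> ('a \<Rightarrow> complex poly)) set" where
  "poly_pairs M n = {(P, P'). (\<forall>i. (\<lambda>q. coeff (P q) i, \<lambda>q. coeff (P' q) i) \<in> M) \<and>
     (\<forall>q. \<forall>i>n. coeff (P q) i = 0 \<and> coeff (P' q) i = 0)}"

lemma poly_pairsI:
  assumes "\<And>i. (\<lambda>q. coeff (P q) i, \<lambda>q. coeff (P' q) i) \<in> M"
    "\<And>q i. i > n \<Longrightarrow> coeff (P q) i = 0" "\<And>q i. i > n \<Longrightarrow> coeff (P' q) i = 0"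
  shows "(P, P') \<in> poly_pairs M n"
  using assms unfolding poly_pairs_def by blast

lemma poly_pairsD:
  assumes "(P, P') \<in> poly_pairs M n"
  shows "(\<lambda>q. coeff (P q) i, \<lambda>q. coeff (P' q) i) \<in> M"
    "i > n \<Longrightarrow> coeff (P q) i = 0" "i > n \<Longrightarrow> coeff (P' q) i = 0"
  using assms unfolding poly_pairs_def by auto

lemma poly_pairs_0:
  assumes "(P, P') \<in> poly_pairs M 0"
  shows "poly (P q) z = coeff (P q) 0" "poly (P' q) z = coeff (P' q) 0" "pderiv (P q) = 0"
    "P q = 0 \<longleftrightarrow> coeff (P q) 0 = 0" "P' q = 0 \<longleftrightarrow> coeff (P' q) 0 = 0"
proof -
  have "p = [:coeff p 0:]" if "\<And>i. i > 0 \<Longrightarrow> coeff p i = 0" for p :: "complex poly"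
    using that by (auto simp: poly_eq_iff coeff_pCons split: nat.split)
  then obtain a b where "P q = [:a:]" "P' q = [:b:]"
    using poly_pairsD(2,3)[OF assms, of _ q] by metis
  then show "poly (P q) z = coeff (P q) 0" "poly (P' q) z = coeff (P' q) 0" "pderiv (P q) = 0"
    "P q = 0 \<longleftrightarrow> coeff (P q) 0 = 0" "P' q = 0 \<longleftrightarrow> coeff (P' q) 0 = 0"
    by (simp_all add: pderiv_pCons)
qed

lemma poly_pairs_mono: "(P, P') \<in> poly_pairs M n \<Longrightarrow> n \<le> m \<Longrightarrow> (P, P') \<in> poly_pairs M m"
  unfolding poly_pairs_def by auto

context
  fixes Q :: "'a topology" and M
  assumes M: "local_derivation Q M"
begin

lemma local_derivation_zero: "(\<lambda>_. 0, \<lambda>_. 0) \<in> M"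
  by (rule local_derivationD(4)[OF M])

lemma poly_pairs_const: "(u, v) \<in> M \<Longrightarrow> (\<lambda>q. [:u q:], \<lambda>q. [:v q:]) \<in> poly_pairs M n"
proof (rule poly_pairsI)
  show "(\<lambda>q. coeff [:u q:] i, \<lambda>q. coeff [:v q:] i) \<in> M" if "(u, v) \<in> M" for i
    using that by (cases i) (auto simp: local_derivation_zero)
qed (auto simp: coeff_pCons split: nat.split)

lemma poly_pairs_X: "(\<lambda>q. [:0, 1:], \<lambda>q. 0) \<in> poly_pairs M 1"
proof (rule poly_pairsI)
  show "(\<lambda>q. coeff [:0, 1:] i, \<lambda>q. coeff 0 i) \<in> M" for i
    by (simp add: local_derivationD(4)[OF M])
qed (auto simp: coeff_pCons split: nat.split)

lemma poly_pairs_add: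
  assumes "(P, P') \<in> poly_pairs M n" "(R, R') \<in> poly_pairs M n"
  shows "(\<lambda>q. P q + R q, \<lambda>q. P' q + R' q) \<in> poly_pairs M n"
  using assms by (intro poly_pairsI)
    (auto simp: poly_pairsD intro: local_derivationD(5)[OF M] poly_pairsD(1))

lemma poly_pairs_diff:
  assumes "(P, P') \<in> poly_pairs M n" "(R, R') \<in> poly_pairs M n"
  shows "(\<lambda>q. P q - R q, \<lambda>q. P' q - R' q) \<in> poly_pairs M n"
  using assms by (intro poly_pairsI)
    (auto simp: poly_pairsD intro: local_derivation_diff[OF M] poly_pairsD(1))

lemma poly_pairs_mult:
  assumes P: "(P, P') \<in> poly_pairs M n" and R: "(R, R') \<in> poly_pairs M m"
  shows "(\<lambda>q. P q * R q, \<lambda>q. P q * R' q + P' q * R q) \<in> poly_pairs M (n + m)"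
proof (rule poly_pairsI)
  fix i
  have "(\<lambda>q. \<Sum>j\<le>i. coeff (P q) j * coeff (R q) (i - j),
      \<lambda>q. \<Sum>j\<le>i. coeff (P q) j * coeff (R' q) (i - j) + coeff (P' q) j * coeff (R q) (i - j)) \<in> M"
    by (intro local_derivation_sum[OF M] local_derivationD(6)[OF M] poly_pairsD(1)[OF P] poly_pairsD(1)[OF R])
  then show "(\<lambda>q. coeff (P q * R q) i, \<lambda>q. coeff (P q * R' q + P' q * R q) i) \<in> M"
    by (simp add: coeff_mult sum.distrib)
next
  have deg: "coeff (p * r) i = 0"
    if "\<And>i. i > n \<Longrightarrow> coeff p i = 0" "\<And>i. i > m \<Longrightarrow> coeff r i = 0" "i > n + m" for p r :: "complex poly" and i
  proof -
    have "degree p \<le> n" "degree r \<le> m" using that by (auto intro: degree_le)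
    then have "degree (p * r) < i" using degree_mult_le[of p r] that(3) by linarith
    then show ?thesis by (rule coeff_eq_0)
  qed
  fix q i assume i: "i > n + m"
  show "coeff (P q * R q) i = 0"
    using i by (intro deg) (auto simp: poly_pairsD[OF P] poly_pairsD[OF R])
  show "coeff (P q * R' q + P' q * R q) i = 0"
    using i deg[of "P q" "R' q" i] deg[of "P' q" "R q" i]
    by (auto simp: poly_pairsD[OF P] poly_pairsD[OF R])
qed

lemma poly_pairs_monom:
  assumes "(u, v) \<in> M"
  shows "(\<lambda>q. monom (u q) k, \<lambda>q. monom (v q) k) \<in> poly_pairs M k"
proof (rule poly_pairsI)
  show "(\<lambda>q. coeff (monom (u q) k) i, \<lambda>q. coeff (monom (v q) k) i) \<in> M" for i
    using assms by (cases "i = k") (auto simp: local_derivation_zero)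
qed auto

lemma poly_pairs_pderiv:
  assumes "(P, P') \<in> poly_pairs M (Suc n)"
  shows "(\<lambda>q. pderiv (P q), \<lambda>q. pderiv (P' q)) \<in> poly_pairs M n"
  using assms by (intro poly_pairsI)
    (auto simp: coeff_pderiv poly_pairsD simp del: of_nat_Suc
          intro!: local_derivation_cmult[OF M] poly_pairsD(1))

lemma poly_pairs_reduce:
  assumes "(P, P') \<in> poly_pairs M (Suc n)"
    "\<And>q. coeff (P q) (Suc n) = 0" "\<And>q. coeff (P' q) (Suc n) = 0"
  shows "(P, P') \<in> poly_pairs M n"
proof (rule poly_pairsI)
  show "(\<lambda>q. coeff (P q) i, \<lambda>q. coeff (P' q) i) \<in> M" for i
    by (rule poly_pairsD(1)[OF assms(1)])
  show "coeff (P q) i = 0" if "i > n" for q i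
    using that assms(2) poly_pairsD(2)[OF assms(1)] by (cases "i = Suc n") auto
  show "coeff (P' q) i = 0" if "i > n" for q i
    using that assms(3) poly_pairsD(3)[OF assms(1)] by (cases "i = Suc n") auto
qed

lemma poly_pairs_truncate:
  assumes "(P, P') \<in> poly_pairs M (Suc n)"
  shows "(\<lambda>q. P q - monom (coeff (P q) (Suc n)) (Suc n),
          \<lambda>q. P' q - monom (coeff (P' q) (Suc n)) (Suc n)) \<in> poly_pairs M n"
  by (rule poly_pairs_reduce[OF poly_pairs_diff[OF assms poly_pairs_monom[OF poly_pairsD(1)[OF assms]]]])
    simp_all

lemma poly_pairs_leading_coeff_zero:
  assumes "(P, P') \<in> poly_pairs M (Suc n)"
  shows "\<forall>\<^sub>F q in generic Q. coeff (P q) (Suc n) = 0 \<longrightarrow>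
    P q - monom (coeff (P q) (Suc n)) (Suc n) = P q \<and> P' q - monom (coeff (P' q) (Suc n)) (Suc n) = P' q"
  using local_derivationD(3)[OF M poly_pairsD(1)[OF assms, of "Suc n"]]
  by (rule eventually_mono) auto

lemma gcont_poly:
  assumes "(P, P') \<in> poly_pairs M n" "gcont Q x"
  shows "gcont Q (\<lambda>q. poly (P q) (x q))" "gcont Q (\<lambda>q. poly (P' q) (x q))"
proof -
  have eq: "poly p z = (\<Sum>i\<le>n. coeff p i * z ^ i)" if "\<And>i. i > n \<Longrightarrow> coeff p i = 0" for p and z :: complex
    unfolding poly_altdef using that
    by (intro sum.mono_neutral_left) (auto intro: degree_le simp: coeff_eq_0)
  have eqP: "poly (P q) z = (\<Sum>i\<le>n. coeff (P q) i * z ^ i)" for q z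
    by (rule eq) (rule poly_pairsD(2)[OF assms(1)])
  have eqP': "poly (P' q) z = (\<Sum>i\<le>n. coeff (P' q) i * z ^ i)" for q z
    by (rule eq) (rule poly_pairsD(3)[OF assms(1)])
  show "gcont Q (\<lambda>q. poly (P q) (x q))"
    unfolding eqP
    by (intro gcont_sum gcont_mult gcont_power assms local_derivationD(1)[OF M poly_pairsD(1)[OF assms(1)]])
  show "gcont Q (\<lambda>q. poly (P' q) (x q))"
    unfolding eqP'
    by (intro gcont_sum gcont_mult gcont_power assms local_derivationD(2)[OF M poly_pairsD(1)[OF assms(1)]])
qed

text \<open>A derivation that extends to \<open>x\<close> must send \<open>x\<close> to \<open>- P'(x) / pderiv P (x)\<close> whenever \<open>x\<close> is
  a simple root of \<open>P\<close>, so two such polynomials have to prescribe the same value. The reason is the Euclidean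
  algorithm. Where the leading coefficient \<open>c\<close> of the polynomial of lower degree is nonzero, the other
  polynomial is reduced by it. Where \<open>c\<close> vanishes, its derivative vanishes too by locality, and the
  leading term can be dropped from \<open>P\<close> and from \<open>P'\<close>.\<close>

lemma poly_pairs_consistent:
  assumes "(P, P') \<in> poly_pairs M n" "(R, R') \<in> poly_pairs M m"
  shows "\<forall>\<^sub>F q in generic Q. poly (P q) (x q) = 0 \<longrightarrow> poly (R q) (x q) = 0 \<longrightarrow>
     poly (pderiv (R q)) (x q) * poly (P' q) (x q) = poly (pderiv (P q)) (x q) * poly (R' q) (x q)"
  using assms
proof (induction "n + m" arbitrary: n m P P' R R' rule: less_induct)
  case less
  have main: "\<forall>\<^sub>F q in generic Q. poly (P q) (x q) = 0 \<longrightarrow> poly (R q) (x q) = 0 \<longrightarrow>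
     poly (pderiv (R q)) (x q) * poly (P' q) (x q) = poly (pderiv (P q)) (x q) * poly (R' q) (x q)"
    if nm: "n + m = N" "n \<le> m" and P: "(P, P') \<in> poly_pairs M n" and R: "(R, R') \<in> poly_pairs M m"
      and IH: "\<And>n m P P' R R'. n + m < N \<Longrightarrow> (P, P') \<in> poly_pairs M n \<Longrightarrow> (R, R') \<in> poly_pairs M m \<Longrightarrow>
        \<forall>\<^sub>F q in generic Q. poly (P q) (x q) = 0 \<longrightarrow> poly (R q) (x q) = 0 \<longrightarrow>
          poly (pderiv (R q)) (x q) * poly (P' q) (x q) = poly (pderiv (P q)) (x q) * poly (R' q) (x q)"
    for n m N P P' R R'
  proof (cases n)
    case 0
    have P0: "(P, P') \<in> poly_pairs M 0" using P 0 by simp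
    show ?thesis
      using local_derivationD(3)[OF M poly_pairsD(1)[OF P, of 0]]
      by (rule eventually_mono) (simp add: poly_pairs_0[OF P0])
  next
    case (Suc k)
    then obtain l where l: "m = Suc l" using nm by (cases m) auto
    define c where "c q = coeff (P q) n" for q
    define c' where "c' q = coeff (P' q) n" for q
    define b where "b q = coeff (R q) m" for q
    define b' where "b' q = coeff (R' q) m" for q
    define P1 where "P1 q = P q - monom (c q) n" for q
    define P1' where "P1' q = P' q - monom (c' q) n" for q
    have P1: "(P1, P1') \<in> poly_pairs M k"
      using poly_pairs_truncate[of P P' k] P Suc unfolding P1_def P1'_def c_def c'_def by simp
    define R1 where "R1 q = monom (c q) 0 * R q - monom (b q) (m - n) * P q" for q
    define R1' where "R1' q = (monom (c q) 0 * R' q + monom (c' q) 0 * R q) -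
        (monom (b q) (m - n) * P' q + monom (b' q) (m - n) * P q)" for q
    have "(R1, R1') \<in> poly_pairs M m"
    proof -
      have "(\<lambda>q. monom (c q) 0 * R q, \<lambda>q. monom (c q) 0 * R' q + monom (c' q) 0 * R q) \<in> poly_pairs M (0 + m)"
        unfolding c_def c'_def by (intro poly_pairs_mult poly_pairs_monom R poly_pairsD(1)[OF P])
      moreover have "(\<lambda>q. monom (b q) (m - n) * P q, \<lambda>q. monom (b q) (m - n) * P' q + monom (b' q) (m - n) * P q)
          \<in> poly_pairs M ((m - n) + n)"
        unfolding b_def b'_def by (intro poly_pairs_mult poly_pairs_monom P poly_pairsD(1)[OF R])
      ultimately show ?thesis
        using nm unfolding R1_def R1'_def by (intro poly_pairs_diff) simp_all
    qed
    then have R1: "(R1, R1') \<in> poly_pairs M l"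
      unfolding l
    proof (rule poly_pairs_reduce)
      have idx: "\<not> m < m - n" "m - (m - n) = n" using nm by simp_all
      show "coeff (R1 q) (Suc l) = 0" for q
        using idx unfolding l[symmetric] R1_def by (simp add: coeff_monom_mult c_def b_def)
      show "coeff (R1' q) (Suc l) = 0" for q
        using idx unfolding l[symmetric] R1'_def
        by (simp add: coeff_monom_mult c_def b_def c'_def b'_def)
    qed
    have 1: "\<forall>\<^sub>F q in generic Q. c q = 0 \<longrightarrow> P1 q = P q \<and> P1' q = P' q"
      using poly_pairs_leading_coeff_zero[of P P' k] P Suc
      unfolding P1_def P1'_def c_def c'_def by simp
    have 2: "\<forall>\<^sub>F q in generic Q. poly (P1 q) (x q) = 0 \<longrightarrow> poly (R q) (x q) = 0 \<longrightarrow>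
       poly (pderiv (R q)) (x q) * poly (P1' q) (x q) = poly (pderiv (P1 q)) (x q) * poly (R' q) (x q)"
      by (rule IH[OF _ P1 R]) (use nm Suc in simp)
    have 3: "\<forall>\<^sub>F q in generic Q. poly (P q) (x q) = 0 \<longrightarrow> poly (R1 q) (x q) = 0 \<longrightarrow>
       poly (pderiv (R1 q)) (x q) * poly (P' q) (x q) = poly (pderiv (P q)) (x q) * poly (R1' q) (x q)"
      by (rule IH[OF _ P R1]) (use nm l in simp)
    from 1 2 3 show ?thesis
    proof eventually_elim
      case (elim q)
      show ?case
      proof (intro impI)
        assume P0: "poly (P q) (x q) = 0" and R0: "poly (R q) (x q) = 0"
        show "poly (pderiv (R q)) (x q) * poly (P' q) (x q) = poly (pderiv (P q)) (x q) * poly (R' q) (x q)"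
        proof (cases "c q = 0")
          case True
          then show ?thesis using elim(1,2) P0 R0 by auto
        next
          case False
          define t where "t = b q * x q ^ (m - n)"
          have "poly (R1 q) (x q) = 0" by (simp add: R1_def P0 R0)
          moreover have "poly (pderiv (R1 q)) (x q) = c q * poly (pderiv (R q)) (x q) - t * poly (pderiv (P q)) (x q)"
            by (simp add: R1_def pderiv_diff pderiv_mult P0 R0 t_def poly_monom pderiv_monom)
          moreover have "poly (R1' q) (x q) = c q * poly (R' q) (x q) - t * poly (P' q) (x q)"
            by (simp add: R1'_def P0 R0 t_def poly_monom)
          ultimately have "(c q * poly (pderiv (R q)) (x q) - t * poly (pderiv (P q)) (x q)) * poly (P' q) (x q) =
              poly (pderiv (P q)) (x q) * (c q * poly (R' q) (x q) - t * poly (P' q) (x q))"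
            using elim(3) P0 by simp
          then have "c q * (poly (pderiv (R q)) (x q) * poly (P' q) (x q)) =
              c q * (poly (pderiv (P q)) (x q) * poly (R' q) (x q))"
            by (simp add: algebra_simps)
          then show ?thesis using False by simp
        qed
      qed
    qed
  qed
  show ?case
  proof (cases "n \<le> m")
    case True
    show ?thesis by (rule main[OF refl True less.prems less.hyps])
  next
    case False
    then have "m \<le> n" by simp
    have "\<forall>\<^sub>F q in generic Q. poly (R q) (x q) = 0 \<longrightarrow> poly (P q) (x q) = 0 \<longrightarrow>
       poly (pderiv (P q)) (x q) * poly (R' q) (x q) = poly (pderiv (R q)) (x q) * poly (P' q) (x q)"
      by (rule main[OF add.commute \<open>m \<le> n\<close> less.prems(2,1) less.hyps])
    then show ?thesis by (rule eventually_mono) simp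
  qed
qed

text \<open>On the set \<open>V\<close> every root \<open>x\<close> of a polynomial is a multiple root. This cannot happen in
  characteristic zero except for the zero polynomial: the formal derivative again vanishes at \<open>x\<close>, so it is
  zero by induction on the degree. Hence the leading coefficient is zero, and by locality so is its
  derivative.\<close>

lemma poly_pairs_transcendental:
  assumes V: "\<And>n P P'. (P, P') \<in> poly_pairs M n \<Longrightarrow>
      \<forall>\<^sub>F q in generic Q. q \<in> V \<longrightarrow> poly (P q) (x q) = 0 \<longrightarrow> poly (pderiv (P q)) (x q) = 0"
    and P: "(P, P') \<in> poly_pairs M n"
  shows "\<forall>\<^sub>F q in generic Q. q \<in> V \<longrightarrow> poly (P q) (x q) = 0 \<longrightarrow> P q = 0 \<and> P' q = 0"
  using P
proof (induction n arbitrary: P P')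
  case 0
  show ?case
    using local_derivationD(3)[OF M poly_pairsD(1)[OF 0, of 0]]
    by (rule eventually_mono) (simp add: poly_pairs_0[OF 0])
next
  case (Suc n)
  note V[OF Suc.prems] Suc.IH[OF poly_pairs_pderiv[OF Suc.prems]]
    poly_pairs_leading_coeff_zero[OF Suc.prems] Suc.IH[OF poly_pairs_truncate[OF Suc.prems]]
  then show ?case
  proof eventually_elim
    case (elim q)
    show ?case
    proof (intro impI)
      assume q: "q \<in> V" "poly (P q) (x q) = 0"
      then have "pderiv (P q) = 0" using elim(1,2) by simp
      then have "coeff (pderiv (P q)) n = 0" by simp
      then have "coeff (P q) (Suc n) = 0"
        by (simp add: coeff_pderiv del: of_nat_Suc)
      then have eq: "P q - monom (coeff (P q) (Suc n)) (Suc n) = P q"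
        "P' q - monom (coeff (P' q) (Suc n)) (Suc n) = P' q" using elim(3) by blast+
      show "P q = 0 \<and> P' q = 0" using elim(4)[unfolded eq] q by blast
    qed
  qed
qed

text \<open>On the open sets where \<open>x\<close> is a simple root of some polynomial over the algebra the value \<open>y\<close> is
  forced; by consistency the forced values glue. Away from all these open sets \<open>x\<close> is generically
  transcendental, any value would do, and gluing supplies zero.\<close>

lemma extension_value_exists:
  assumes x: "gcont Q x"
  shows "\<exists>y. gcont Q y \<and> (\<forall>n. \<forall>(P, P')\<in>poly_pairs M n. \<forall>\<^sub>F q in generic Q.
     poly (P q) (x q) = 0 \<longrightarrow> poly (P' q) (x q) + y q * poly (pderiv (P q)) (x q) = 0)"
proof -
  have pd: "gcont Q (\<lambda>q. poly (pderiv (P q)) (x q))" if "(P, P') \<in> poly_pairs M n" for P P' n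
    using gcont_poly(1)[OF poly_pairs_pderiv[OF poly_pairs_mono[OF that]] x, of n] by simp
  define root where "root P q \<longleftrightarrow> poly (P q) (x q) = 0 \<and> poly (pderiv (P q)) (x q) \<noteq> 0" for P q
  define val where "val P P' q = - poly (P' q) (x q) / poly (pderiv (P q)) (x q)" for P P' q
  define F where "F = {(V, val P P') | V P P' n. openin Q V \<and> (P, P') \<in> poly_pairs M n \<and>
     (\<forall>q\<in>V. root P q \<and> cont_at Q (val P P') q)}"
  have F_E: "\<exists>n P P'. openin Q V \<and> (P, P') \<in> poly_pairs M n \<and> h = val P P' \<and>
      (\<forall>q\<in>V. root P q \<and> cont_at Q (val P P') q)" if "(V, h) \<in> F" for V h
    using that unfolding F_def by blast
  have cF: "cont_at Q h q" if "(V, h) \<in> F" "q \<in> V" for V h q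
    using F_E[OF that(1)] that(2) by blast
  have agree: "h q = h' q" if F: "(V, h) \<in> F" "(V', h') \<in> F" and q: "q \<in> V" "q \<in> V'" for V h V' h' q
  proof -
    obtain n P P' where P: "openin Q V" "(P, P') \<in> poly_pairs M n" "h = val P P'"
      "\<forall>q\<in>V. root P q \<and> cont_at Q (val P P') q" using F_E[OF F(1)] by blast
    obtain m R R' where R: "openin Q V'" "(R, R') \<in> poly_pairs M m" "h' = val R R'"
      "\<forall>q\<in>V'. root R q \<and> cont_at Q (val R R') q" using F_E[OF F(2)] by blast
    have eq: "val P P' q = val R R' q"
      if "poly (P q) (x q) = 0 \<longrightarrow> poly (R q) (x q) = 0 \<longrightarrow>
        poly (pderiv (R q)) (x q) * poly (P' q) (x q) = poly (pderiv (P q)) (x q) * poly (R' q) (x q)"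
        "root P q" "root R q" for q
      using that unfolding root_def val_def by (simp add: frac_eq_eq mult.commute)
    \<comment> \<open>Both sides are continuous, so generic equality on the overlap is equality there.\<close>
    show "h q = h' q"
      unfolding P(3) R(3)
    proof (rule cont_at_eq_if_generic_eq[where V = "V \<inter> V'" and f = "val P P'" and h = "val R R'" and Q = Q])
      show "openin Q (V \<inter> V')" using P R by auto
      show "\<forall>\<^sub>F q in generic Q. q \<in> V \<inter> V' \<longrightarrow> val P P' q = val R R' q"
        using poly_pairs_consistent[OF P(2) R(2), of x]
        by (rule eventually_mono) (use eq P(4) R(4) in blast)
      show "q \<in> V \<inter> V'" using q by blast
      show "cont_at Q (val P P') p" if "p \<in> V \<inter> V'" for p using P(4) that by blast
      show "cont_at Q (val R R') p" if "p \<in> V \<inter> V'" for p using R(4) that by blast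
    qed
  qed
  have opF: "openin Q V" if "(V, h) \<in> F" for V h using F_E[OF that] by blast
  have "\<exists>y. gcont Q y \<and> (\<forall>(V, h)\<in>F. \<forall>q\<in>V. y q = h q)"
  proof (rule gcont_glue)
    show "openin Q V" if "(V, h) \<in> F" for V h using opF that .
    show "cont_at Q h q" if "(V, h) \<in> F" "q \<in> V" for V h q using cF that .
    show "h q = h' q" if "(V, h) \<in> F" "(V', h') \<in> F" "q \<in> V" "q \<in> V'" for V h V' h' q using agree that .
  qed
  then obtain y where y: "gcont Q y" "\<And>V h q. (V, h) \<in> F \<Longrightarrow> q \<in> V \<Longrightarrow> y q = h q"
    by blast
  show ?thesis
  proof (intro exI[of _ y] conjI y(1) allI ballI case_prodI2)
    fix n p P P' assume "p \<in> poly_pairs M n" "p = (P, P')"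
    then have P: "(P, P') \<in> poly_pairs M n" by simp
    show "\<forall>\<^sub>F q in generic Q. poly (P q) (x q) = 0 \<longrightarrow> poly (P' q) (x q) + y q * poly (pderiv (P q)) (x q) = 0"
      unfolding eventually_generic_local
    proof (intro allI impI)
      fix U assume U: "openin Q U" "U \<noteq> {}"
      let ?goal = "\<lambda>W. openin Q W \<and> W \<noteq> {} \<and> W \<subseteq> U \<and> (\<forall>q\<in>W. poly (P q) (x q) = 0 \<longrightarrow>
          poly (P' q) (x q) + y q * poly (pderiv (P q)) (x q) = 0)"
      show "\<exists>W. ?goal W"
      proof (cases "\<exists>V h. (V, h) \<in> F \<and> U \<inter> V \<noteq> {}")
        \<comment> \<open>If \<open>U\<close> meets an algebraic piece, \<open>y\<close> is given there by some \<open>R\<close>, and \<open>P\<close> is consistent with \<open>R\<close>.\<close>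
        case True
        then obtain V h where V: "(V, h) \<in> F" "U \<inter> V \<noteq> {}" by blast
        obtain m R R' where R: "openin Q V" "(R, R') \<in> poly_pairs M m" "h = val R R'"
          "\<forall>q\<in>V. root R q \<and> cont_at Q (val R R') q" using F_E[OF V(1)] by blast
        have "openin Q (U \<inter> V)" using U R(1) by auto
        with poly_pairs_consistent[OF P R(2), of x] obtain W where W: "openin Q W" "W \<noteq> {}" "W \<subseteq> U \<inter> V"
          "\<forall>q\<in>W. poly (P q) (x q) = 0 \<longrightarrow> poly (R q) (x q) = 0 \<longrightarrow>
             poly (pderiv (R q)) (x q) * poly (P' q) (x q) = poly (pderiv (P q)) (x q) * poly (R' q) (x q)"
          using V(2) by (rule eventually_generic_obtains)
        have "poly (P' q) (x q) + y q * poly (pderiv (P q)) (x q) = 0" if "q \<in> W" "poly (P q) (x q) = 0" for q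
        proof -
          have q: "q \<in> V" using that W by blast
          then have Rq: "poly (R q) (x q) = 0" "poly (pderiv (R q)) (x q) \<noteq> 0"
            using R(4) unfolding root_def by blast+
          have "y q = - poly (R' q) (x q) / poly (pderiv (R q)) (x q)"
            using y(2)[OF V(1) q] unfolding R(3) val_def .
          moreover have "poly (pderiv (R q)) (x q) * poly (P' q) (x q) = poly (pderiv (P q)) (x q) * poly (R' q) (x q)"
            using W(4) Rq that by blast
          moreover have "a + (- b / d) * e = 0" if "d * a = e * b" "d \<noteq> 0" for a b d e :: complex
            using that by (simp add: field_simps)
          ultimately show ?thesis using Rq(2) by metis
        qed
        then show ?thesis using W by (intro exI[of _ W]) auto
      next
        \<comment> \<open>Otherwise a simple root inside \<open>U\<close> would itself be an algebraic piece, so there is none.\<close>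
        case False
        have V: "\<forall>\<^sub>F q in generic Q. q \<in> U \<longrightarrow> poly (R q) (x q) = 0 \<longrightarrow> poly (pderiv (R q)) (x q) = 0"
          if R: "(R, R') \<in> poly_pairs M m" for m R R'
          unfolding eventually_generic_local
        proof (intro allI impI)
          fix A assume A: "openin Q A" "A \<noteq> {}"
          let ?goal = "\<lambda>V. openin Q V \<and> V \<noteq> {} \<and> V \<subseteq> A \<and>
            (\<forall>q\<in>V. q \<in> U \<longrightarrow> poly (R q) (x q) = 0 \<longrightarrow> poly (pderiv (R q)) (x q) = 0)"
          show "\<exists>V. ?goal V"
          proof (cases "A \<inter> U = {}")
            case True
            then show ?thesis using A by (intro exI[of _ A]) auto
          next
            case ne: False
            have "openin Q (A \<inter> U)" using A U by auto
            with gcont_poly(1)[OF R x] obtain V1 where V1: "openin Q V1" "V1 \<noteq> {}" "V1 \<subseteq> A \<inter> U"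
              "(\<forall>q\<in>V1. poly (R q) (x q) = 0) \<or> (\<forall>q\<in>V1. poly (R q) (x q) \<noteq> 0)"
              using ne by (rule gcont_zero_or_nonzero)
            from pd[OF R] V1(1,2) obtain V2 where V2: "openin Q V2" "V2 \<noteq> {}" "V2 \<subseteq> V1"
              "\<forall>q\<in>V2. cont_at Q (\<lambda>q. poly (pderiv (R q)) (x q)) q"
              "(\<forall>q\<in>V2. poly (pderiv (R q)) (x q) = 0) \<or> (\<forall>q\<in>V2. poly (pderiv (R q)) (x q) \<noteq> 0)"
              by (rule gcont_zero_or_nonzero)
            from gcont_poly(2)[OF R x, unfolded gcont_def] V2(1,2) obtain V3
              where V3: "openin Q V3" "V3 \<noteq> {}" "V3 \<subseteq> V2" "\<forall>q\<in>V3. cont_at Q (\<lambda>q. poly (R' q) (x q)) q"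
              by (rule eventually_generic_obtains)
            have sub: "V3 \<subseteq> A" "V3 \<subseteq> U" "V3 \<subseteq> V1" using V1 V2 V3 by auto
            have "\<not> ((\<forall>q\<in>V3. poly (R q) (x q) = 0) \<and> (\<forall>q\<in>V3. poly (pderiv (R q)) (x q) \<noteq> 0))"
            proof
              assume *: "(\<forall>q\<in>V3. poly (R q) (x q) = 0) \<and> (\<forall>q\<in>V3. poly (pderiv (R q)) (x q) \<noteq> 0)"
              have "cont_at Q (val R R') q" if "q \<in> V3" for q
                unfolding val_def using * V2(4) V3(3,4) that by (intro tendsto_divide tendsto_minus) blast+
              moreover have "root R q" if "q \<in> V3" for q using * that unfolding root_def by blast
              ultimately have "(V3, val R R') \<in> F" unfolding F_def using V3(1) R by blast
              then show False using False V3(2) sub(2) by blast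
            qed
            then have "?goal V3" using V1(4) V2(5) V3 sub by blast
            then show ?thesis by blast
          qed
        qed
        from poly_pairs_transcendental[OF V P] U obtain W where W: "openin Q W" "W \<noteq> {}" "W \<subseteq> U"
            "\<forall>q\<in>W. q \<in> U \<longrightarrow> poly (P q) (x q) = 0 \<longrightarrow> P q = 0 \<and> P' q = 0"
          by (rule eventually_generic_obtains)
        then show ?thesis by (intro exI[of _ W]) auto
      qed
    qed
  qed
qed

text \<open>The new graph consists of the values at \<open>x\<close> of all polynomials over the old algebra, paired with
  the values that the product rule dictates once \<open>y\<close> is the derivative of \<open>x\<close>. The choice of \<open>y\<close> is
  exactly what makes it local.\<close>

lemma local_derivation_adjoin:
  assumes x: "gcont Q x"
  shows "\<exists>N y. local_derivation Q N \<and> M \<subseteq> N \<and> (x, y) \<in> N"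
proof -
  obtain y where y: "gcont Q y"
    "\<And>n P P'. (P, P') \<in> poly_pairs M n \<Longrightarrow>
       \<forall>\<^sub>F q in generic Q. poly (P q) (x q) = 0 \<longrightarrow> poly (P' q) (x q) + y q * poly (pderiv (P q)) (x q) = 0"
    using extension_value_exists[OF x] by blast
  define ev where "ev P = (\<lambda>q. poly (P q) (x q))" for P :: "'a \<Rightarrow> complex poly"
  define dv where "dv P P' = (\<lambda>q. poly (P' q) (x q) + y q * poly (pderiv (P q)) (x q))" for P P' :: "'a \<Rightarrow> complex poly"
  define N where "N = {(ev P, dv P P') | P P' n. (P, P') \<in> poly_pairs M n}"
  have N_I: "(u, v) \<in> N" if "(P, P') \<in> poly_pairs M n" "u = ev P" "v = dv P P'" for u v P P' n
    using that unfolding N_def by blast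
  have MN: "(u, v) \<in> N" if "(u, v) \<in> M" for u v
    by (rule N_I[OF poly_pairs_const[OF that, of 0]]) (auto simp: ev_def dv_def)
  have "local_derivation Q N"
    unfolding local_derivation_def
  proof (intro conjI ballI allI case_prodI2)
    fix p u v assume "p \<in> N" "p = (u, v)"
    then obtain P P' n where P: "(P, P') \<in> poly_pairs M n" and uv: "u = ev P" "v = dv P P'"
      unfolding N_def by blast
    show "gcont Q u" unfolding uv ev_def by (rule gcont_poly[OF P x])
    show "gcont Q v" unfolding uv dv_def
      using gcont_poly[OF P x] gcont_poly(1)[OF poly_pairs_pderiv[OF poly_pairs_mono[OF P]] x, of n] y(1)
      by (intro gcont_add gcont_mult) auto
    show "\<forall>\<^sub>F q in generic Q. u q = 0 \<longrightarrow> v q = 0" unfolding uv ev_def dv_def by (rule y(2)[OF P])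
    fix p' u' v' assume "p' \<in> N" "p' = (u', v')"
    then obtain R R' m where R: "(R, R') \<in> poly_pairs M m" and uv': "u' = ev R" "v' = dv R R'"
      unfolding N_def by blast
    show "(\<lambda>q. u q + u' q, \<lambda>q. v q + v' q) \<in> N"
      unfolding uv uv'
      by (rule N_I[OF poly_pairs_add[OF poly_pairs_mono[OF P, of "max n m"] poly_pairs_mono[OF R, of "max n m"]]])
        (auto simp: ev_def dv_def pderiv_add algebra_simps)
    show "(\<lambda>q. u q * u' q, \<lambda>q. u q * v' q + v q * u' q) \<in> N"
      unfolding uv uv'
      by (rule N_I[OF poly_pairs_mult[OF P R]])
        (auto simp: ev_def dv_def pderiv_mult algebra_simps)
  next
    fix c show "(\<lambda>_. c, \<lambda>_. 0) \<in> N" by (rule MN[OF local_derivationD(4)[OF M]])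
  qed
  moreover have "(x, y) \<in> N"
    by (rule N_I[OF poly_pairs_X]) (auto simp: ev_def dv_def pderiv_pCons)
  moreover have "M \<subseteq> N" using MN by auto
  ultimately show ?thesis by blast
qed

end

text \<open>By Zorn's lemma there is a maximal extension, and a maximal one cannot omit any function, since
  that function could be adjoined.\<close>

theorem local_derivation_extends:
  assumes M0: "local_derivation Q M0"
  shows "\<exists>M. local_derivation Q M \<and> M0 \<subseteq> M \<and> (\<forall>x. gcont Q x \<longrightarrow> (\<exists>y. (x, y) \<in> M))"
proof -
  define S where "S = {M. local_derivation Q M \<and> M0 \<subseteq> M}"
  have "\<exists>M\<in>S. \<forall>N\<in>S. M \<subseteq> N \<longrightarrow> N = M"
  proof (rule subset_Zorn_nonempty)
    show "S \<noteq> {}" using M0 unfolding S_def by blast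
    fix C assume C: "C \<noteq> {}" "subset.chain S C"
    have sub: "C \<subseteq> S" using C(2) by (simp add: subset_chain_def)
    have two: "\<exists>M\<in>C. p \<in> M \<and> p' \<in> M" if p: "p \<in> \<Union>C" "p' \<in> \<Union>C" for p p'
    proof -
      from p obtain A B where "A \<in> C" "B \<in> C" "p \<in> A" "p' \<in> B" by blast
      moreover have "A \<subseteq> B \<or> B \<subseteq> A" using calculation C(2) by (simp add: subset_chain_def)
      ultimately show ?thesis by blast
    qed
    have "local_derivation Q (\<Union>C)"
      unfolding local_derivation_def
    proof (intro conjI ballI allI case_prodI2)
      fix p u v assume p: "p \<in> \<Union>C" "p = (u, v)"
      then obtain M where "M \<in> C" "(u, v) \<in> M" by blast
      then show "gcont Q u" "gcont Q v" "\<forall>\<^sub>F q in generic Q. u q = 0 \<longrightarrow> v q = 0"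
        using sub local_derivationD(1-3)[of Q M u v] unfolding S_def by blast+
      fix p' u' v' assume "p' \<in> \<Union>C" "p' = (u', v')"
      then obtain M where "M \<in> C" "(u, v) \<in> M" "(u', v') \<in> M" using two p by blast
      then show "(\<lambda>q. u q + u' q, \<lambda>q. v q + v' q) \<in> \<Union>C"
        "(\<lambda>q. u q * u' q, \<lambda>q. u q * v' q + v q * u' q) \<in> \<Union>C"
        using sub local_derivationD(5,6)[of Q M u v u' v'] unfolding S_def by blast+
    next
      fix c show "(\<lambda>_. c, \<lambda>_. 0) \<in> \<Union>C" using C(1) sub local_derivationD(4)[of Q _ c] unfolding S_def by blast
    qed
    moreover have "M0 \<subseteq> \<Union>C" using C(1) sub unfolding S_def by blast
    ultimately show "\<Union>C \<in> S" unfolding S_def by blast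
  qed
  then obtain M where M: "M \<in> S" and max: "\<forall>N\<in>S. M \<subseteq> N \<longrightarrow> N = M" by (rule bexE)
  have M': "local_derivation Q M" "M0 \<subseteq> M" using M unfolding S_def by simp_all
  have "\<exists>y. (x, y) \<in> M" if x: "gcont Q x" for x
  proof -
    obtain N y where N: "local_derivation Q N" "M \<subseteq> N" "(x, y) \<in> N"
      using local_derivation_adjoin[OF M'(1) x] by blast
    have "N \<in> S" using N(1,2) M'(2) unfolding S_def by simp
    then have "N = M" using max N(2) by simp
    then show ?thesis using N(3) by (intro exI[of _ y]) simp
  qed
  then show ?thesis using M' by (intro exI[of _ M]) simp
qed

section \<open>The Stone space of a complete Boolean algebra\<close>

lemma stone_clopen_inf: "stone_clopen (inf a b) = stone_clopen a \<inter> stone_clopen b"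
proof -
  have "inf a b \<in> U \<longleftrightarrow> a \<in> U \<and> b \<in> U" if U: "ultrafilter_on_algebra U" for U
    using U unfolding ultrafilter_on_algebra_def by (meson inf_le1 inf_le2)
  then show ?thesis unfolding stone_clopen_def by blast
qed

lemma stone_clopen_compl: "stone_clopen (- a) = topspace stone_space - stone_clopen a"
proof -
  have "- a \<in> U \<longleftrightarrow> a \<notin> U" if U: "ultrafilter_on_algebra U" for U
    using U unfolding ultrafilter_on_algebra_def by (metis inf_compl_bot)
  then show ?thesis unfolding stone_clopen_def topspace_stone_space by blast
qed

lemma stone_clopen_mono: "a \<le> b \<Longrightarrow> stone_clopen a \<subseteq> stone_clopen b"
  unfolding stone_clopen_def ultrafilter_on_algebra_def by blast

lemma stone_clopen_bot [simp]: "stone_clopen bot = {}"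
  by (auto simp: stone_clopen_def ultrafilter_on_algebra_def)

lemma stone_clopen_top [simp]: "stone_clopen top = topspace stone_space"
  by (auto simp: stone_clopen_def topspace_stone_space ultrafilter_on_algebra_def)

lemma stone_clopen_subset: "stone_clopen a \<subseteq> topspace stone_space"
  unfolding stone_clopen_def topspace_stone_space by blast

lemma openin_stone_clopen [simp, intro]: "openin stone_space (stone_clopen a)"
  unfolding stone_space_def by (simp add: topology_generated_by_Basis)

lemma openin_stone_contains_clopen:
  assumes "openin stone_space U" "q \<in> U"
  shows "\<exists>a. q \<in> stone_clopen a \<and> stone_clopen a \<subseteq> U"
proof -
  have "generate_topology_on (range stone_clopen) U"
    using assms(1) unfolding stone_space_def openin_topology_generated_by_iff .
  then show ?thesis using assms(2)
  proof (induction arbitrary: q)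
    case (Int A B)
    then obtain a b where "q \<in> stone_clopen a" "stone_clopen a \<subseteq> A" "q \<in> stone_clopen b" "stone_clopen b \<subseteq> B"
      by (meson IntD1 IntD2)
    then show ?case by (intro exI[of _ "inf a b"]) (auto simp: stone_clopen_inf)
  qed blast+
qed

text \<open>The ultrafilter theorem, by Zorn: a filter that decides neither \<open>b\<close> nor \<open>- b\<close> can be enlarged by \<open>b\<close>.\<close>

lemma ultrafilter_exists:
  assumes "(a :: 'b::boolean_algebra) \<noteq> bot"
  shows "stone_clopen a \<noteq> {}"
proof -
  define S where "S = {F. a \<in> F \<and> bot \<notin> F \<and> (\<forall>b\<in>F. \<forall>c\<in>F. inf b c \<in> F) \<and> (\<forall>b\<in>F. \<forall>c. b \<le> c \<longrightarrow> c \<in> F)}"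
  have "\<exists>F\<in>S. \<forall>G\<in>S. F \<subseteq> G \<longrightarrow> G = F"
  proof (rule subset_Zorn_nonempty)
    have "{b. a \<le> b} \<in> S" using assms unfolding S_def by (auto simp: bot_unique intro: order_trans)
    then show "S \<noteq> {}" by blast
    fix C assume C: "C \<noteq> {}" "subset.chain S C"
    have sub: "C \<subseteq> S" using C(2) by (simp add: subset_chain_def)
    show "\<Union>C \<in> S"
      unfolding S_def mem_Collect_eq
    proof (intro conjI ballI allI impI)
      show "a \<in> \<Union>C" "bot \<notin> \<Union>C" using C(1) sub unfolding S_def by auto
      show "c \<in> \<Union>C" if "b \<in> \<Union>C" "b \<le> c" for b c using that sub unfolding S_def by blast
      fix b c assume "b \<in> \<Union>C" "c \<in> \<Union>C"
      then obtain A B where AB: "A \<in> C" "B \<in> C" "b \<in> A" "c \<in> B" by blast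
      then have "A \<subseteq> B \<or> B \<subseteq> A" using C(2) by (simp add: subset_chain_def)
      then have "\<exists>D\<in>C. b \<in> D \<and> c \<in> D" using AB by blast
      then show "inf b c \<in> \<Union>C" using sub unfolding S_def by blast
    qed
  qed
  then obtain F where FS: "F \<in> S" and max: "\<forall>G\<in>S. F \<subseteq> G \<longrightarrow> G = F" by (rule bexE)
  have F: "a \<in> F" "bot \<notin> F" "\<And>b c. b \<in> F \<Longrightarrow> c \<in> F \<Longrightarrow> inf b c \<in> F" "\<And>b c. b \<in> F \<Longrightarrow> b \<le> c \<Longrightarrow> c \<in> F"
    using FS unfolding S_def by blast+
  have "b \<in> F \<or> - b \<in> F" for b
  proof (rule ccontr)
    assume nb: "\<not> (b \<in> F \<or> - b \<in> F)"
    define G where "G = {c. \<exists>f\<in>F. inf f b \<le> c}"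
    have "F \<subseteq> G" unfolding G_def by (auto intro: le_infI1)
    have "b \<in> G" unfolding G_def using F(1) by auto
    have "G \<in> S"
      unfolding S_def mem_Collect_eq
    proof (intro conjI ballI allI impI)
      show "a \<in> G" using F(1) \<open>F \<subseteq> G\<close> by blast
      show "bot \<notin> G"
      proof
        assume "bot \<in> G"
        then obtain f where f: "f \<in> F" "inf f b = bot" unfolding G_def by (auto simp: bot_unique)
        then have "f \<le> - b" by (simp add: inf_shunt)
        then show False using F(4) f(1) nb by blast
      qed
      show "d \<in> G" if "c \<in> G" "c \<le> d" for c d using that unfolding G_def by (auto intro: order_trans)
      fix c d assume "c \<in> G" "d \<in> G"
      then obtain f g where fg: "f \<in> F" "g \<in> F" "inf f b \<le> c" "inf g b \<le> d" unfolding G_def by blast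
      have "inf (inf f g) b \<le> inf f b" "inf (inf f g) b \<le> inf g b"
        by (auto intro: le_infI1 le_infI2)
      then have "inf (inf f g) b \<le> inf c d" using fg(3,4) by (meson le_inf_iff order_trans)
      then show "inf c d \<in> G" using F(3)[OF fg(1,2)] unfolding G_def by blast
    qed
    then have "G = F" using max \<open>F \<subseteq> G\<close> by blast
    then show False using \<open>b \<in> G\<close> nb by blast
  qed
  moreover have "top \<in> F" using F(4)[OF F(1)] by simp
  ultimately have "ultrafilter_on_algebra F"
    using F unfolding ultrafilter_on_algebra_def by blast
  then show ?thesis using F(1) unfolding stone_clopen_def by blast
qed

lemma stone_clopen_empty_iff [simp]: "stone_clopen a = {} \<longleftrightarrow> a = bot"
  using ultrafilter_exists stone_clopen_bot by metis

lemma openin_stone_nonempty_contains_clopen: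
  assumes "openin stone_space U" "U \<noteq> {}"
  shows "\<exists>a. a \<noteq> bot \<and> stone_clopen a \<subseteq> U"
proof -
  obtain q where "q \<in> U" using assms(2) by blast
  then obtain a where a: "q \<in> stone_clopen a" "stone_clopen a \<subseteq> U"
    using openin_stone_contains_clopen[OF assms(1)] by blast
  then have "a \<noteq> bot" by auto
  then show ?thesis using a(2) by blast
qed

lemma stone_clopen_subset_iff: "stone_clopen a \<subseteq> stone_clopen b \<longleftrightarrow> a \<le> b"
proof
  assume "stone_clopen a \<subseteq> stone_clopen b"
  then have "stone_clopen (inf a (- b)) = {}"
    by (auto simp: stone_clopen_inf stone_clopen_compl)
  then show "a \<le> b" by (simp add: inf_shunt)
qed (rule stone_clopen_mono)

lemma stone_cont_at_nbhd:
  assumes "cont_at stone_space f q" "q \<in> topspace stone_space" "open W" "f q \<in> W"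
  shows "\<exists>a. q \<in> stone_clopen a \<and> (\<forall>p\<in>stone_clopen a. f p \<in> W)"
proof -
  obtain U where U: "openin stone_space U" "q \<in> U" "f ` U \<subseteq> W"
    using assms(1)[unfolded cont_at_iff[OF assms(2)], rule_format, of W] assms(3,4) by blast
  obtain a where "q \<in> stone_clopen a" "stone_clopen a \<subseteq> U"
    using openin_stone_contains_clopen[OF U(1,2)] by blast
  then show ?thesis using U(3) by (intro exI[of _ a]) auto
qed

text \<open>Completeness of the algebra enters here: the separating element is the supremum of all elements on
  which \<open>h < s\<close>. A point of \<open>D\<close> below it with \<open>h > s\<close> would have a clopen neighbourhood disjoint from all
  these elements, hence from their supremum.\<close>

lemma clopen_threshold:
  fixes h :: "'b::{boolean_algebra,complete_lattice} set \<Rightarrow> real"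
  assumes D: "dense_open stone_space D" and h: "\<forall>q\<in>D. cont_at stone_space h q"
  shows "\<exists>b. (\<forall>p\<in>stone_clopen b \<inter> D. h p \<le> s) \<and> (\<forall>p\<in>stone_clopen (- b) \<inter> D. s \<le> h p)"
proof -
  define S where "S = {a. \<forall>p\<in>stone_clopen a \<inter> D. h p < s}"
  have nbhd: "\<exists>c. p \<in> stone_clopen c \<and> (\<forall>r\<in>stone_clopen c. h r \<in> W)" if "p \<in> D" "open W" "h p \<in> W" for p W
  proof -
    have "p \<in> topspace stone_space" using that D openin_subset unfolding dense_open_def by blast
    then show ?thesis using h that by (intro stone_cont_at_nbhd) auto
  qed
  have "h p \<le> s" if p: "p \<in> stone_clopen (Sup S)" "p \<in> D" for p
  proof (rule ccontr)
    assume "\<not> h p \<le> s"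
    then obtain c where c: "p \<in> stone_clopen c" "\<forall>r\<in>stone_clopen c. h r \<in> {s<..}"
      using nbhd[of p "{s<..}"] p(2) by auto
    have "inf a c = bot" if "a \<in> S" for a
    proof (rule ccontr)
      assume "inf a c \<noteq> bot"
      then have "stone_clopen (inf a c) \<inter> D \<noteq> {}"
        using D unfolding dense_open_def by simp
      then obtain r where r: "r \<in> stone_clopen a" "r \<in> stone_clopen c" "r \<in> D"
        unfolding stone_clopen_inf by blast
      have "h r < s" using that r(1,3) unfolding S_def by blast
      moreover have "s < h r" using c(2) r(2) by simp
      ultimately show False by simp
    qed
    then have "Sup S \<le> - c" by (intro Sup_least) (simp add: inf_shunt)
    then have "p \<in> stone_clopen (- c)" using p(1) stone_clopen_mono by blast
    then show False using c(1) by (simp add: stone_clopen_compl)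
  qed
  moreover have "s \<le> h p" if p: "p \<in> stone_clopen (- Sup S)" "p \<in> D" for p
  proof (rule ccontr)
    assume "\<not> s \<le> h p"
    then obtain c where c: "p \<in> stone_clopen c" "\<forall>r\<in>stone_clopen c. h r \<in> {..<s}"
      using nbhd[of p "{..<s}"] p(2) by auto
    then have "c \<in> S" unfolding S_def by blast
    then have "c \<le> Sup S" by (rule Sup_upper)
    then have "p \<in> stone_clopen (Sup S)" using c(1) stone_clopen_mono by blast
    then show False using p(1) by (simp add: stone_clopen_compl)
  qed
  ultimately show ?thesis by blast
qed

section \<open>Arithmetic of \<open>C\<^sub>\<infinity>(Q)\<close>\<close>

definition rval :: "('a \<Rightarrow> ereal) \<Rightarrow> 'a \<Rightarrow> real" where
  "rval x q = real_of_ereal (x q)"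

lemma C_inf_cont_at: "x \<in> C_inf Q \<Longrightarrow> q \<in> topspace Q \<Longrightarrow> cont_at Q x q"
  unfolding C_inf_def continuous_map_iff_cont_at by blast

lemma dense_open_finite_part:
  assumes "x \<in> C_inf Q"
  shows "dense_open Q (finite_part Q x)"
proof -
  have "closedin Q {q \<in> topspace Q. x q \<in> {\<infinity>, - \<infinity>}}"
    using assms unfolding C_inf_def by (intro closedin_continuous_map_preimage[where Y = euclidean]) auto
  moreover have inf_eq: "{q \<in> topspace Q. x q \<in> {\<infinity>, - \<infinity>}} = {q \<in> topspace Q. \<bar>x q\<bar> = \<infinity>}" by auto
  ultimately have cl: "closedin Q {q \<in> topspace Q. \<bar>x q\<bar> = \<infinity>}" by simp
  have fp: "finite_part Q x = topspace Q - {q \<in> topspace Q. \<bar>x q\<bar> = \<infinity>}"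
    unfolding finite_part_def by auto
  have int: "Q interior_of {q \<in> topspace Q. \<bar>x q\<bar> = \<infinity>} = {}"
    using assms cl unfolding C_inf_def by (simp add: closure_of_closedin)
  show ?thesis
    unfolding dense_open_def
  proof (intro conjI allI impI)
    show "openin Q (finite_part Q x)" unfolding fp using cl by blast
    fix U assume U: "openin Q U" "U \<noteq> {}"
    show "U \<inter> finite_part Q x \<noteq> {}"
    proof
      assume "U \<inter> finite_part Q x = {}"
      then have "U \<subseteq> {q \<in> topspace Q. \<bar>x q\<bar> = \<infinity>}" using openin_subset[OF U(1)] unfolding fp by blast
      then show False using interior_of_maximal U int by blast
    qed
  qed
qed

lemma finite_part_rval: "q \<in> finite_part Q x \<Longrightarrow> x q = ereal (rval x q)"
  unfolding finite_part_def rval_def by (auto simp: ereal_real)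

lemma cont_at_rval:
  assumes "x \<in> C_inf Q" "q \<in> finite_part Q x"
  shows "cont_at Q (rval x) q"
proof -
  have "(x \<longlongrightarrow> ereal (rval x q)) (nhdsin Q q)"
    using C_inf_cont_at[OF assms(1), of q] assms(2) finite_part_rval[OF assms(2)]
    unfolding finite_part_def by simp
  then have "((\<lambda>p. real_of_ereal (x p)) \<longlongrightarrow> rval x q) (nhdsin Q q)" by (rule lim_real_of_ereal)
  then show ?thesis unfolding rval_def[abs_def] .
qed

lemma gcont_rval: "x \<in> C_inf Q \<Longrightarrow> gcont Q (rval x)"
  unfolding gcont_def using eventually_dense_open[OF dense_open_finite_part]
  by (rule eventually_mono) (auto intro: cont_at_rval)

lemma eventually_finite: "x \<in> C_inf Q \<Longrightarrow> \<forall>\<^sub>F q in generic Q. x q = ereal (rval x q)"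
  using eventually_dense_open[OF dense_open_finite_part]
  by (rule eventually_mono) (auto intro: finite_part_rval)

lemma C_inf_eqI:
  assumes "x \<in> C_inf Q" "y \<in> C_inf Q" "\<forall>\<^sub>F q in generic Q. rval x q = rval y q"
  shows "x = y"
proof
  fix q
  have ev: "\<forall>\<^sub>F q in generic Q. q \<in> topspace Q \<longrightarrow> x q = y q"
    using eventually_finite[OF assms(1)] eventually_finite[OF assms(2)] assms(3)
    by eventually_elim simp
  show "x q = y q"
  proof (cases "q \<in> topspace Q")
    case True
    show ?thesis
      by (rule cont_at_eq_if_generic_eq[OF _ ev]) (use True assms C_inf_cont_at in auto)
  next
    case False
    have "x \<in> extensional (topspace Q)" "y \<in> extensional (topspace Q)"
      using assms(1,2) unfolding C_inf_def by blast+
    then show ?thesis using False extensional_arb by metis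
  qed
qed

lemma C_inf_I:
  assumes z: "z \<in> extensional (topspace Q)" "\<forall>q\<in>topspace Q. cont_at Q z q"
    and D: "dense_open Q D" "\<forall>q\<in>D. \<bar>z q\<bar> \<noteq> \<infinity>"
  shows "z \<in> C_inf Q"
proof -
  let ?I = "{q \<in> topspace Q. \<bar>z q\<bar> = \<infinity>}"
  have "openin Q D" using D(1) unfolding dense_open_def by blast
  then have "D \<inter> Q closure_of ?I = {}"
    using D(2) openin_Int_closure_of_eq_empty[of Q D ?I] by auto
  then have "Q interior_of (Q closure_of ?I) \<inter> D = {}" using interior_of_subset[of Q "Q closure_of ?I"] by blast
  then have "Q interior_of (Q closure_of ?I) = {}"
    by (rule dense_openD[OF D(1) openin_interior_of])
  then show ?thesis using z unfolding C_inf_def continuous_map_iff_cont_at by simp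
qed

text \<open>The extension is the lower limit of \<open>h\<close>. Lower limits are lower semicontinuous on any space; upper
  semicontinuity comes from separating the levels of \<open>h\<close> by clopen sets.\<close>

lemma continuous_extension:
  fixes h :: "'b::{boolean_algebra,complete_lattice} set \<Rightarrow> real"
  assumes D: "dense_open stone_space D" and h: "\<forall>q\<in>D. cont_at stone_space h q"
  shows "\<exists>z\<in>C_inf stone_space. \<forall>q\<in>D. z q = ereal (h q)"
proof -
  let ?Q = "stone_space :: 'b set topology"
  define lower where "lower q = {s. \<exists>a. q \<in> stone_clopen a \<and> (\<forall>p\<in>stone_clopen a \<inter> D. s \<le> h p)}" for q
  define z where "z = restrict (\<lambda>q. SUP s\<in>lower q. ereal s) (topspace ?Q)"
  have Dtop: "D \<subseteq> topspace ?Q" using D openin_subset unfolding dense_open_def by blast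
  have zD: "z q = ereal (h q)" if q: "q \<in> D" for q
  proof (rule antisym)
    have qt: "q \<in> topspace ?Q" using q Dtop by blast
    have zq: "z q = (SUP s\<in>lower q. ereal s)" using qt unfolding z_def by simp
    show "z q \<le> ereal (h q)"
      unfolding zq
    proof (rule SUP_least)
      fix s assume "s \<in> lower q"
      then show "ereal s \<le> ereal (h q)" using q unfolding lower_def by auto
    qed
    show "ereal (h q) \<le> z q"
    proof (rule ereal_le_epsilon2)
      fix e :: real assume e: "0 < e"
      have "open {h q - e<..}" "h q \<in> {h q - e<..}" using e by auto
      then obtain a where "q \<in> stone_clopen a" "\<forall>p\<in>stone_clopen a. h p \<in> {h q - e<..}"
        using stone_cont_at_nbhd[OF h[rule_format, OF q] qt] by blast
      then have "h q - e \<in> lower q" unfolding lower_def by force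
      then have "ereal (h q - e) \<le> z q" unfolding zq by (rule SUP_upper)
      then show "ereal (h q) \<le> z q + ereal e"
        by (cases "z q") auto
    qed
  qed
  have "cont_at ?Q z q" if q: "q \<in> topspace ?Q" for q
  proof (rule order_tendstoI)
    have zp: "z p = (SUP s\<in>lower p. ereal s)" if "p \<in> stone_clopen a" for p a
      using that stone_clopen_subset unfolding z_def by auto
    have zq: "z q = (SUP s\<in>lower q. ereal s)" using q unfolding z_def by simp
    fix x assume "x < z q"
    then obtain s where s: "s \<in> lower q" "x < ereal s" unfolding zq by (auto simp: less_SUP_iff)
    then obtain a where a: "q \<in> stone_clopen a" "\<forall>p\<in>stone_clopen a \<inter> D. s \<le> h p" unfolding lower_def by blast
    have "x < z p" if "p \<in> stone_clopen a" for p
    proof -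
      have "s \<in> lower p" using a(2) that unfolding lower_def by blast
      then have "ereal s \<le> z p" unfolding zp[OF that] by (rule SUP_upper)
      then show ?thesis using s(2) by simp
    qed
    then show "\<forall>\<^sub>F p in nhdsin ?Q q. x < z p"
      unfolding eventually_nhdsin using a(1) by (intro disjI2 exI[of _ "stone_clopen a"]) auto
  next
    have zp: "z p = (SUP s\<in>lower p. ereal s)" if "p \<in> stone_clopen a" for p a
      using that stone_clopen_subset unfolding z_def by auto
    have zq: "z q = (SUP s\<in>lower q. ereal s)" using q unfolding z_def by simp
    fix x assume "z q < x"
    then obtain t where t: "z q < ereal t" "ereal t < x" using ereal_dense2 by blast
    obtain b where b: "\<forall>p\<in>stone_clopen b \<inter> D. h p \<le> t" "\<forall>p\<in>stone_clopen (- b) \<inter> D. t \<le> h p"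
      using clopen_threshold[OF D h] by blast
    have "q \<notin> stone_clopen (- b)"
    proof
      assume "q \<in> stone_clopen (- b)"
      then have "t \<in> lower q" using b(2) unfolding lower_def by blast
      then have "ereal t \<le> z q" unfolding zq by (rule SUP_upper)
      then show False using t(1) by simp
    qed
    then have qb: "q \<in> stone_clopen b" using q by (simp add: stone_clopen_compl)
    have "z p < x" if p: "p \<in> stone_clopen b" for p
    proof -
      have "z p \<le> ereal t"
        unfolding zp[OF p]
      proof (rule SUP_least)
        fix s assume "s \<in> lower p"
        then obtain a where a: "p \<in> stone_clopen a" "\<forall>r\<in>stone_clopen a \<inter> D. s \<le> h r" unfolding lower_def by blast
        have "openin ?Q (stone_clopen (inf a b))" "stone_clopen (inf a b) \<noteq> {}"
          using a(1) p by (auto simp: stone_clopen_inf simp del: stone_clopen_empty_iff)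
        then obtain r where "r \<in> stone_clopen (inf a b)" "r \<in> D" using D unfolding dense_open_def by blast
        then have "s \<le> h r" "h r \<le> t" using a(2) b(1) by (auto simp: stone_clopen_inf)
        then show "ereal s \<le> ereal t" by simp
      qed
      then show ?thesis using t(2) by simp
    qed
    then show "\<forall>\<^sub>F p in nhdsin ?Q q. z p < x"
      unfolding eventually_nhdsin using qb by (intro disjI2 exI[of _ "stone_clopen b"]) auto
  qed
  then have "z \<in> C_inf ?Q"
    using D zD by (intro C_inf_I[where D = D]) (auto simp: z_def)
  then show ?thesis using zD by blast
qed

lemma cont_ext_spec:
  fixes h :: "'b::{boolean_algebra,complete_lattice} set \<Rightarrow> real"
  assumes D: "dense_open stone_space D" and h: "\<forall>q\<in>D. cont_at stone_space h q" and f: "\<forall>q\<in>D. f q = ereal (h q)"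
  shows "cont_ext stone_space D f \<in> C_inf stone_space \<and>
    (\<forall>\<^sub>F q in generic stone_space. rval (cont_ext stone_space D f) q = h q)"
proof -
  obtain z where z: "z \<in> C_inf stone_space" "\<forall>q\<in>D. z q = ereal (h q)"
    using continuous_extension[OF D h] by blast
  have "cont_ext stone_space D f = z"
    unfolding cont_ext_def
  proof (rule the_equality)
    show "z \<in> C_inf stone_space \<and> (\<forall>q\<in>D. z q = f q)" using z f by simp
    fix w assume w: "w \<in> C_inf stone_space \<and> (\<forall>q\<in>D. w q = f q)"
    have "\<forall>\<^sub>F q in generic stone_space. rval w q = rval z q"
      using eventually_dense_open[OF D] by (rule eventually_mono) (use w z f in \<open>simp add: rval_def\<close>)
    then show "w = z" using w z C_inf_eqI by blast
  qed
  moreover have "\<forall>\<^sub>F q in generic stone_space. rval z q = h q"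
    using eventually_dense_open[OF D] by (rule eventually_mono) (use z in \<open>simp add: rval_def\<close>)
  ultimately show ?thesis using z(1) by blast
qed

context
  fixes x y :: "'b::{boolean_algebra,complete_lattice} set \<Rightarrow> ereal"
  assumes x: "x \<in> C_inf stone_space" and y: "y \<in> C_inf stone_space"
begin

lemma L0_add_spec: "L0_add stone_space x y \<in> C_inf stone_space \<and>
    (\<forall>\<^sub>F q in generic stone_space. rval (L0_add stone_space x y) q = rval x q + rval y q)"
  unfolding L0_add_def using dense_open_finite_part[OF x] dense_open_finite_part[OF y]
  by (intro cont_ext_spec dense_open_Int)
    (auto intro!: tendsto_add cont_at_rval[OF x] cont_at_rval[OF y] simp: finite_part_rval[of _ stone_space])

lemma L0_diff_spec: "L0_diff stone_space x y \<in> C_inf stone_space \<and>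
    (\<forall>\<^sub>F q in generic stone_space. rval (L0_diff stone_space x y) q = rval x q - rval y q)"
  unfolding L0_diff_def using dense_open_finite_part[OF x] dense_open_finite_part[OF y]
  by (intro cont_ext_spec dense_open_Int)
    (auto intro!: tendsto_diff cont_at_rval[OF x] cont_at_rval[OF y] simp: finite_part_rval[of _ stone_space])

lemma L0_mult_spec: "L0_mult stone_space x y \<in> C_inf stone_space \<and>
    (\<forall>\<^sub>F q in generic stone_space. rval (L0_mult stone_space x y) q = rval x q * rval y q)"
  unfolding L0_mult_def using dense_open_finite_part[OF x] dense_open_finite_part[OF y]
  by (intro cont_ext_spec dense_open_Int)
    (auto intro!: tendsto_mult cont_at_rval[OF x] cont_at_rval[OF y] simp: finite_part_rval[of _ stone_space])

end

lemma L0_scale_spec: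
  fixes x :: "'b::{boolean_algebra,complete_lattice} set \<Rightarrow> ereal"
  assumes x: "x \<in> C_inf stone_space"
  shows "L0_scale stone_space c x \<in> C_inf stone_space \<and>
    (\<forall>\<^sub>F q in generic stone_space. rval (L0_scale stone_space c x) q = c * rval x q)"
  unfolding L0_scale_def using dense_open_finite_part[OF x]
  by (intro cont_ext_spec)
    (auto intro!: tendsto_mult cont_at_rval[OF x] simp: finite_part_rval[of _ stone_space])

lemma continuous_C_inf:
  assumes "\<forall>q\<in>topspace Q. cont_at Q h q"
  shows "restrict (\<lambda>q. ereal (h q)) (topspace Q) \<in> C_inf Q"
    and "q \<in> topspace Q \<Longrightarrow> rval (restrict (\<lambda>q. ereal (h q)) (topspace Q)) q = h q"
proof -
  have "cont_at Q (restrict (\<lambda>q. ereal (h q)) (topspace Q)) q" if "q \<in> topspace Q" for q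
    using assms that cont_at_cong_open[of Q "topspace Q" q "restrict (\<lambda>q. ereal (h q)) (topspace Q)" "\<lambda>q. ereal (h q)"]
    by auto
  then show "restrict (\<lambda>q. ereal (h q)) (topspace Q) \<in> C_inf Q"
    by (intro C_inf_I[where D = "topspace Q"] dense_open_topspace) auto
qed (simp add: rval_def)

lemma L0_zero_spec: "L0_zero Q \<in> C_inf Q" "\<forall>\<^sub>F q in generic Q. rval (L0_zero Q) q = 0"
proof -
  have eq: "L0_zero Q = restrict (\<lambda>q. ereal 0) (topspace Q)" unfolding L0_zero_def by (simp add: zero_ereal_def)
  show "L0_zero Q \<in> C_inf Q" unfolding eq by (rule continuous_C_inf) simp
  show "\<forall>\<^sub>F q in generic Q. rval (L0_zero Q) q = 0"
    using eventually_generic_topspace by (rule eventually_mono) (simp add: L0_zero_def rval_def)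
qed

section \<open>The complexification\<close>

definition cval :: "'a L0C \<Rightarrow> 'a \<Rightarrow> complex" where
  "cval z q = Complex (rval (fst z) q) (rval (snd z) q)"

lemma gcont_cval: "z \<in> L0C Q \<Longrightarrow> gcont Q (cval z)"
proof -
  assume "z \<in> L0C Q"
  then have "gcont Q (rval (fst z))" "gcont Q (rval (snd z))" unfolding L0C_def by (auto intro: gcont_rval)
  then show "gcont Q (cval z)"
    unfolding gcont_def cval_def[abs_def]
    by (rule eventually_elim2) (rule tendsto_Complex)
qed

text \<open>With the rules for the operations below, this identifies \<open>L0C Q\<close> with generically continuous complex
  functions modulo generic equality, so that identities in \<open>L0C Q\<close> are checked at single points.\<close>

lemma L0C_eqI:
  assumes "z \<in> L0C Q" "w \<in> L0C Q" "\<forall>\<^sub>F q in generic Q. cval z q = cval w q"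
  shows "z = w"
proof (rule prod_eqI)
  show "fst z = fst w"
    using assms by (intro C_inf_eqI[of _ Q]) (auto simp: L0C_def cval_def elim!: eventually_mono)
  show "snd z = snd w"
    using assms by (intro C_inf_eqI[of _ Q]) (auto simp: L0C_def cval_def elim!: eventually_mono)
qed

lemma L0C_zero_spec: "L0C_zero Q \<in> L0C Q" "\<forall>\<^sub>F q in generic Q. cval (L0C_zero Q) q = 0"
proof -
  show "L0C_zero Q \<in> L0C Q" unfolding L0C_def L0C_zero_def using L0_zero_spec(1)[of Q] by simp
  show "\<forall>\<^sub>F q in generic Q. cval (L0C_zero Q) q = 0"
    using L0_zero_spec(2)[of Q] by (rule eventually_mono) (simp add: cval_def L0C_zero_def complex_eq_iff)
qed

context
  fixes z w :: "'b::{boolean_algebra,complete_lattice} set L0C"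
  assumes z: "z \<in> L0C stone_space" and w: "w \<in> L0C stone_space"
begin

lemma L0C_components: "fst z \<in> C_inf stone_space" "snd z \<in> C_inf stone_space"
    "fst w \<in> C_inf stone_space" "snd w \<in> C_inf stone_space"
  using z w unfolding L0C_def by auto

lemma L0C_add_spec: "L0C_add stone_space z w \<in> L0C stone_space"
    "\<forall>\<^sub>F q in generic stone_space. cval (L0C_add stone_space z w) q = cval z q + cval w q"
proof -
  note 1 = L0_add_spec[OF L0C_components(1,3)] and 2 = L0_add_spec[OF L0C_components(2,4)]
  show "L0C_add stone_space z w \<in> L0C stone_space" using 1 2 unfolding L0C_add_def L0C_def by simp
  show "\<forall>\<^sub>F q in generic stone_space. cval (L0C_add stone_space z w) q = cval z q + cval w q"
    using 1[THEN conjunct2] 2[THEN conjunct2]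
    by eventually_elim (simp add: cval_def L0C_add_def complex_eq_iff)
qed

lemma L0C_mult_spec: "L0C_mult stone_space z w \<in> L0C stone_space"
    "\<forall>\<^sub>F q in generic stone_space. cval (L0C_mult stone_space z w) q = cval z q * cval w q"
proof -
  note m = L0_mult_spec[OF L0C_components(1,3)] L0_mult_spec[OF L0C_components(2,4)]
    L0_mult_spec[OF L0C_components(1,4)] L0_mult_spec[OF L0C_components(2,3)]
  note 1 = L0_diff_spec[OF m(1)[THEN conjunct1] m(2)[THEN conjunct1]]
    and 2 = L0_add_spec[OF m(3)[THEN conjunct1] m(4)[THEN conjunct1]]
  show "L0C_mult stone_space z w \<in> L0C stone_space" using 1 2 unfolding L0C_mult_def L0C_def by simp
  show "\<forall>\<^sub>F q in generic stone_space. cval (L0C_mult stone_space z w) q = cval z q * cval w q"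
    using 1[THEN conjunct2] 2[THEN conjunct2] m[THEN conjunct2]
    by eventually_elim (simp add: cval_def L0C_mult_def complex_eq_iff)
qed

end

lemma L0C_scale_spec:
  fixes z :: "'b::{boolean_algebra,complete_lattice} set L0C"
  assumes z: "z \<in> L0C stone_space"
  shows "L0C_scale stone_space c z \<in> L0C stone_space"
    "\<forall>\<^sub>F q in generic stone_space. cval (L0C_scale stone_space c z) q = c * cval z q"
proof -
  have L0C_components: "fst z \<in> C_inf stone_space" "snd z \<in> C_inf stone_space" using z unfolding L0C_def by auto
  note m = L0_scale_spec[OF L0C_components(1), where c = "Re c"] L0_scale_spec[OF L0C_components(2), where c = "Im c"]
    L0_scale_spec[OF L0C_components(2), where c = "Re c"] L0_scale_spec[OF L0C_components(1), where c = "Im c"]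
  note 1 = L0_diff_spec[OF m(1)[THEN conjunct1] m(2)[THEN conjunct1]]
    and 2 = L0_add_spec[OF m(3)[THEN conjunct1] m(4)[THEN conjunct1]]
  show "L0C_scale stone_space c z \<in> L0C stone_space" using 1 2 unfolding L0C_scale_def L0C_def by simp
  show "\<forall>\<^sub>F q in generic stone_space. cval (L0C_scale stone_space c z) q = c * cval z q"
    using 1[THEN conjunct2] 2[THEN conjunct2] m[THEN conjunct2]
    by eventually_elim (simp add: cval_def L0C_scale_def complex_eq_iff)
qed

lemma L0C_cnj_spec:
  fixes z :: "'b::{boolean_algebra,complete_lattice} set L0C"
  assumes z: "z \<in> L0C stone_space"
  shows "L0C_cnj stone_space z \<in> L0C stone_space"
    "\<forall>\<^sub>F q in generic stone_space. cval (L0C_cnj stone_space z) q = cnj (cval z q)"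
proof -
  have L0C_components: "fst z \<in> C_inf stone_space" "snd z \<in> C_inf stone_space" using z unfolding L0C_def by auto
  note 1 = L0_scale_spec[OF L0C_components(2), where c = "-1"]
  show "L0C_cnj stone_space z \<in> L0C stone_space" using 1 L0C_components(1) unfolding L0C_cnj_def L0C_def by simp
  show "\<forall>\<^sub>F q in generic stone_space. cval (L0C_cnj stone_space z) q = cnj (cval z q)"
    using 1[THEN conjunct2] by eventually_elim (simp add: cval_def L0C_cnj_def complex_eq_iff)
qed

lemma L0_of_gcont:
  fixes h :: "'b::{boolean_algebra,complete_lattice} set \<Rightarrow> real"
  assumes "gcont stone_space h"
  shows "\<exists>x\<in>C_inf stone_space. \<forall>\<^sub>F q in generic stone_space. rval x q = h q"
proof -
  obtain D where D: "dense_open stone_space D" "\<forall>q\<in>D. cont_at stone_space h q"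
    using assms unfolding gcont_def eventually_generic by blast
  obtain x where x: "x \<in> C_inf stone_space" "\<forall>q\<in>D. x q = ereal (h q)"
    using continuous_extension[OF D] by blast
  have "\<forall>\<^sub>F q in generic stone_space. rval x q = h q"
    using eventually_dense_open[OF D(1)] by (rule eventually_mono) (use x(2) in \<open>simp add: rval_def\<close>)
  then show ?thesis using x(1) by blast
qed

lemma L0C_of_gcont:
  fixes f :: "'b::{boolean_algebra,complete_lattice} set \<Rightarrow> complex"
  assumes "gcont stone_space f"
  shows "\<exists>z\<in>L0C stone_space. \<forall>\<^sub>F q in generic stone_space. cval z q = f q"
proof -
  have "gcont stone_space (\<lambda>q. Re (f q))" "gcont stone_space (\<lambda>q. Im (f q))"
    using assms by (auto intro!: gcont_continuous_compose[of _ f] continuous_intros)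
  then obtain x y where xy: "x \<in> C_inf stone_space" "\<forall>\<^sub>F q in generic stone_space. rval x q = Re (f q)"
    "y \<in> C_inf stone_space" "\<forall>\<^sub>F q in generic stone_space. rval y q = Im (f q)"
    using L0_of_gcont by metis
  have "\<forall>\<^sub>F q in generic stone_space. cval (x, y) q = f q"
    using xy(2,4) by eventually_elim (simp add: cval_def complex_eq_iff)
  then show ?thesis using xy(1,3) unfolding L0C_def by (intro bexI[of _ "(x, y)"]) auto
qed

lemma CC_embed_spec:
  assumes "\<forall>q\<in>topspace Q. cont_at Q f q"
  shows "CC_embed Q f \<in> CC Q" "CC_embed Q f \<in> L0C Q" "q \<in> topspace Q \<Longrightarrow> cval (CC_embed Q f) q = f q"
proof -
  show "CC_embed Q f \<in> CC Q" using assms unfolding CC_def continuous_map_iff_cont_at by blast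
  have "\<forall>q\<in>topspace Q. cont_at Q (\<lambda>q. Re (f q)) q" "\<forall>q\<in>topspace Q. cont_at Q (\<lambda>q. Im (f q)) q"
    using assms by (auto intro!: tendsto_intros)
  note continuous_C_inf[OF this(1)] continuous_C_inf[OF this(2)]
  then show "CC_embed Q f \<in> L0C Q" "q \<in> topspace Q \<Longrightarrow> cval (CC_embed Q f) q = f q"
    unfolding CC_embed_def L0C_def cval_def by (simp_all add: complex_eq_iff)
qed

lemma CC_E:
  assumes "x \<in> CC Q"
  shows "x \<in> L0C Q" "q \<in> topspace Q \<Longrightarrow> cont_at Q (cval x) q"
proof -
  obtain f where f: "x = CC_embed Q f" "\<forall>q\<in>topspace Q. cont_at Q f q"
    using assms unfolding CC_def continuous_map_iff_cont_at by blast
  show "x \<in> L0C Q" unfolding f(1) by (rule CC_embed_spec(2)[OF f(2)])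
  show "cont_at Q (cval x) q" if q: "q \<in> topspace Q"
    using cont_at_cong_open[OF openin_topspace q, of "cval x" f] f(2) q CC_embed_spec(3)[OF f(2)]
    unfolding f(1) by blast
qed

text \<open>The description that determines the modulus is met by the extension of the pointwise norm: a function in \<open>C\<^sub>\<infinity>(Q)\<close>
  that is generically nonnegative is nonnegative everywhere, and nonnegative square roots are unique.\<close>

lemma L0C_mod_spec:
  fixes z :: "'b::{boolean_algebra,complete_lattice} set L0C"
  assumes z: "z \<in> L0C stone_space"
  shows "L0C_mod stone_space z \<in> C_inf stone_space"
    "\<forall>\<^sub>F q in generic stone_space. rval (L0C_mod stone_space z) q = norm (cval z q)"
proof -
  let ?Q = "stone_space :: 'b set topology"
  have "gcont ?Q (\<lambda>q. norm (cval z q))"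
    by (rule gcont_continuous_compose[OF gcont_cval[OF z]]) (intro continuous_intros)
  then obtain r where r: "r \<in> C_inf ?Q" "\<forall>\<^sub>F q in generic ?Q. rval r q = norm (cval z q)"
    using L0_of_gcont by blast
  note zz = L0C_mult_spec[OF L0C_cnj_spec(1)[OF z] z]
  have ev_zz: "\<forall>\<^sub>F q in generic ?Q. cval (L0C_mult ?Q (L0C_cnj ?Q z) z) q = complex_of_real ((norm (cval z q))\<^sup>2)"
    using zz(2) L0C_cnj_spec(2)[OF z] by eventually_elim (metis complex_norm_square mult.commute)
  have char: "(L0_mult ?Q s s, L0_zero ?Q) = L0C_mult ?Q (L0C_cnj ?Q z) z \<longleftrightarrow>
      (\<forall>\<^sub>F q in generic ?Q. (rval s q)\<^sup>2 = (norm (cval z q))\<^sup>2)" if s: "s \<in> C_inf ?Q" for s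
  proof -
    note ss = L0_mult_spec[OF s s]
    have in1: "(L0_mult ?Q s s, L0_zero ?Q) \<in> L0C ?Q" using ss L0_zero_spec(1) unfolding L0C_def by auto
    have ev: "\<forall>\<^sub>F q in generic ?Q. cval (L0_mult ?Q s s, L0_zero ?Q) q = complex_of_real ((rval s q)\<^sup>2)"
      using ss[THEN conjunct2] L0_zero_spec(2)
      by eventually_elim (simp add: cval_def complex_eq_iff power2_eq_square)
    show ?thesis
    proof
      assume eq: "(L0_mult ?Q s s, L0_zero ?Q) = L0C_mult ?Q (L0C_cnj ?Q z) z"
      show "\<forall>\<^sub>F q in generic ?Q. (rval s q)\<^sup>2 = (norm (cval z q))\<^sup>2"
        using ev[unfolded eq] ev_zz by eventually_elim (metis of_real_eq_iff)
    next
      assume "\<forall>\<^sub>F q in generic ?Q. (rval s q)\<^sup>2 = (norm (cval z q))\<^sup>2"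
      with ev ev_zz have "\<forall>\<^sub>F q in generic ?Q.
          cval (L0_mult ?Q s s, L0_zero ?Q) q = cval (L0C_mult ?Q (L0C_cnj ?Q z) z) q"
        by eventually_elim simp
      then show "(L0_mult ?Q s s, L0_zero ?Q) = L0C_mult ?Q (L0C_cnj ?Q z) z"
        by (rule L0C_eqI[OF in1 zz(1)])
    qed
  qed
  have "L0C_mod ?Q z = r"
    unfolding L0C_mod_def
  proof (rule the_equality)
    have "0 \<le> r q" if q: "q \<in> topspace ?Q" for q
    proof -
      have rc: "cont_at ?Q r p" if "p \<in> topspace ?Q" for p using C_inf_cont_at[OF r(1) that] .
      have mc: "cont_at ?Q (\<lambda>q. max 0 (r q)) p" if "p \<in> topspace ?Q" for p
        using rc[OF that] by (intro tendsto_max tendsto_const)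
      have "\<forall>\<^sub>F q in generic ?Q. q \<in> topspace ?Q \<longrightarrow> r q = max 0 (r q)"
        using r(2) eventually_finite[OF r(1)] by eventually_elim (simp add: max_def)
      then have "r q = max 0 (r q)"
        using cont_at_eq_if_generic_eq[of ?Q "topspace ?Q" r "\<lambda>q. max 0 (r q)" q] rc mc q by simp
      then show ?thesis by (metis max.cobounded1)
    qed
    moreover have "(L0_mult ?Q r r, L0_zero ?Q) = L0C_mult ?Q (L0C_cnj ?Q z) z"
      unfolding char[OF r(1)] using r(2) by (rule eventually_mono) simp
    ultimately show "r \<in> C_inf ?Q \<and> (\<forall>q\<in>topspace ?Q. 0 \<le> r q) \<and>
        (L0_mult ?Q r r, L0_zero ?Q) = L0C_mult ?Q (L0C_cnj ?Q z) z" using r(1) by blast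
  next
    fix s assume s: "s \<in> C_inf ?Q \<and> (\<forall>q\<in>topspace ?Q. 0 \<le> s q) \<and>
        (L0_mult ?Q s s, L0_zero ?Q) = L0C_mult ?Q (L0C_cnj ?Q z) z"
    then have "\<forall>\<^sub>F q in generic ?Q. (rval s q)\<^sup>2 = (norm (cval z q))\<^sup>2" using char by blast
    then have "\<forall>\<^sub>F q in generic ?Q. rval s q = rval r q"
      using r(2) eventually_generic_topspace
    proof eventually_elim
      case (elim q)
      have "0 \<le> rval s q" using s elim(3) by (auto simp: rval_def intro: real_of_ereal_pos)
      then show ?case using elim(1,2) by (simp add: power2_eq_iff_nonneg)
    qed
    then show "s = r" using C_inf_eqI s r(1) by blast
  qed
  then show "L0C_mod ?Q z \<in> C_inf ?Q" "\<forall>\<^sub>F q in generic ?Q. rval (L0C_mod ?Q z) q = norm (cval z q)"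
    using r by auto
qed

section \<open>Supports\<close>

text \<open>The relation \<open>e |z| = 0\<close> in terms of values.\<close>

definition vanishes :: "'b::boolean_algebra set L0C \<Rightarrow> 'b \<Rightarrow> bool" where
  "vanishes z e \<longleftrightarrow> (\<forall>\<^sub>F q in generic stone_space. q \<in> stone_clopen e \<longrightarrow> cval z q = 0)"

lemma idem_spec: "idem e \<in> C_inf stone_space" "\<forall>\<^sub>F q in generic stone_space. rval (idem e) q = indicator (stone_clopen e) q"
proof -
  let ?h = "indicator (stone_clopen e) :: _ \<Rightarrow> real"
  have eq: "idem e = restrict (\<lambda>q. ereal (?h q)) (topspace stone_space)"
    unfolding idem_def by (auto simp: indicator_def zero_ereal_def one_ereal_def fun_eq_iff)
  have c: "\<forall>q\<in>topspace stone_space. cont_at stone_space ?h q"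
  proof
    fix q :: "'a set" assume q: "q \<in> topspace stone_space"
    define a where "a = (if q \<in> stone_clopen e then e else - e)"
    have qa: "q \<in> stone_clopen a" using q by (auto simp: a_def stone_clopen_compl)
    have const: "?h p = ?h q" if "p \<in> stone_clopen a" for p
      using that by (auto simp: a_def stone_clopen_compl indicator_def split: if_splits)
    have "cont_at stone_space ?h q \<longleftrightarrow> cont_at stone_space (\<lambda>_. ?h q) q"
      by (rule cont_at_cong_open[OF openin_stone_clopen qa const])
    then show "cont_at stone_space ?h q" by simp
  qed
  show "idem e \<in> C_inf stone_space" unfolding eq by (rule continuous_C_inf(1)[OF c])
  show "\<forall>\<^sub>F q in generic stone_space. rval (idem e) q = ?h q"
    using eventually_generic_topspace unfolding eq
    by (rule eventually_mono) (rule continuous_C_inf(2)[OF c])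
qed

lemma nonvanishing_clopen:
  assumes z: "gcont stone_space (cval z)" and nv: "\<not> vanishes z e"
  shows "\<exists>a. a \<noteq> bot \<and> a \<le> e \<and> (\<forall>q\<in>stone_clopen a. cval z q \<noteq> 0)"
proof (rule ccontr)
  assume no: "\<not> ?thesis"
  have "vanishes z e"
    unfolding vanishes_def eventually_generic_local
  proof (intro allI impI)
    fix U :: "'a set set" assume U: "openin stone_space U" "U \<noteq> {}"
    let ?goal = "\<lambda>V. openin stone_space V \<and> V \<noteq> {} \<and> V \<subseteq> U \<and> (\<forall>q\<in>V. q \<in> stone_clopen e \<longrightarrow> cval z q = 0)"
    show "\<exists>V. ?goal V"
    proof (cases "U \<inter> stone_clopen e = {}")
      case True
      then have "?goal U" using U by auto
      then show ?thesis by (rule exI)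
    next
      case False
      have "openin stone_space (U \<inter> stone_clopen e)" using U by auto
      with z obtain V where V: "openin stone_space V" "V \<noteq> {}" "V \<subseteq> U \<inter> stone_clopen e"
        "(\<forall>q\<in>V. cval z q = 0) \<or> (\<forall>q\<in>V. cval z q \<noteq> 0)"
        using False by (rule gcont_zero_or_nonzero)
      obtain a where a: "a \<noteq> bot" "stone_clopen a \<subseteq> V"
        using openin_stone_nonempty_contains_clopen[OF V(1,2)] by blast
      then have "a \<le> e" using V(3) stone_clopen_subset_iff by blast
      then have "\<not> (\<forall>q\<in>V. cval z q \<noteq> 0)" using no a by blast
      then have "\<forall>q\<in>V. cval z q = 0" using V(4) by argo
      then have "?goal V" using V(1-3) by simp
      then show ?thesis by (rule exI)
    qed
  qed
  then show False using nv by contradiction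
qed

lemma vanishes_nonzero_bot:
  assumes "vanishes z a" "\<forall>q\<in>stone_clopen a. cval z q \<noteq> 0"
  shows "a = bot"
proof (rule ccontr)
  assume "a \<noteq> bot"
  then have "stone_clopen a \<noteq> {}" by simp
  with assms(1)[unfolded vanishes_def] openin_stone_clopen
  obtain V where "V \<noteq> {}" "V \<subseteq> stone_clopen a" "\<forall>q\<in>V. q \<in> stone_clopen a \<longrightarrow> cval z q = 0"
    by (rule eventually_generic_obtains)
  then show False using assms(2) by blast
qed

lemma vanishes_mono: "vanishes z e \<Longrightarrow> a \<le> e \<Longrightarrow> vanishes z a"
  unfolding vanishes_def using stone_clopen_mono by (fastforce elim: eventually_mono)

lemma supp_eq:
  fixes z :: "'b::{boolean_algebra,complete_lattice} set L0C"
  assumes z: "z \<in> L0C stone_space"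
  shows "supp z = - Sup {e. vanishes z e}"
proof -
  have "L0_mult stone_space (idem e) (L0C_mod stone_space z) = L0_zero stone_space \<longleftrightarrow> vanishes z e" for e :: 'b
  proof -
    note m = L0_mult_spec[OF idem_spec(1)[of e] L0C_mod_spec(1)[OF z]]
    have ev: "\<forall>\<^sub>F q in generic stone_space.
        (rval (L0_mult stone_space (idem e) (L0C_mod stone_space z)) q = rval (L0_zero stone_space) q) \<longleftrightarrow>
        (q \<in> stone_clopen e \<longrightarrow> cval z q = 0)"
      using m[THEN conjunct2] idem_spec(2)[of e] L0C_mod_spec(2)[OF z] L0_zero_spec(2)
      by eventually_elim (auto simp: indicator_def)
    have "L0_mult stone_space (idem e) (L0C_mod stone_space z) = L0_zero stone_space \<longleftrightarrow>
      (\<forall>\<^sub>F q in generic stone_space.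
        rval (L0_mult stone_space (idem e) (L0C_mod stone_space z)) q = rval (L0_zero stone_space) q)"
      using C_inf_eqI[OF m[THEN conjunct1] L0_zero_spec(1)] by auto
    also have "\<dots> \<longleftrightarrow> vanishes z e" unfolding vanishes_def using ev by (rule eventually_subst)
    finally show ?thesis .
  qed
  then show ?thesis unfolding supp_def by simp
qed

text \<open>The supremum that defines the support is attained: if \<open>z\<close> did not vanish on \<open>e\<close>, some nonzero
  \<open>a \<le> e\<close> would carry no zero of \<open>z\<close> and be disjoint from every element on which \<open>z\<close> vanishes.\<close>

lemma vanishes_iff_supp:
  fixes z :: "'b::{boolean_algebra,complete_lattice} set L0C"
  assumes z: "z \<in> L0C stone_space"
  shows "vanishes z e \<longleftrightarrow> e \<le> - supp z"
proof
  show "e \<le> - supp z" if "vanishes z e"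
    unfolding supp_eq[OF z] using that by (simp add: Sup_upper)
  assume e: "e \<le> - supp z"
  show "vanishes z e"
  proof (rule ccontr)
    assume "\<not> vanishes z e"
    then obtain a where a: "a \<noteq> bot" "a \<le> e" "\<forall>q\<in>stone_clopen a. cval z q \<noteq> 0"
      using nonvanishing_clopen[OF gcont_cval[OF z]] by blast
    have "c \<le> - a" if "vanishes z c" for c
    proof -
      have "vanishes z (inf c a)" by (rule vanishes_mono[OF that]) simp
      moreover have "\<forall>q\<in>stone_clopen (inf c a). cval z q \<noteq> 0" using a(3) by (simp add: stone_clopen_inf)
      ultimately have "inf c a = bot" by (rule vanishes_nonzero_bot)
      then show ?thesis by (simp add: inf_shunt)
    qed
    then have "Sup {c. vanishes z c} \<le> - a" by (intro Sup_least) simp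
    then have "a \<le> - a" using a(2) e unfolding supp_eq[OF z] by simp
    then show False using a(1) by (simp add: inf_shunt[symmetric])
  qed
qed

lemma supp_le_iff:
  fixes z w :: "'b::{boolean_algebra,complete_lattice} set L0C"
  assumes "z \<in> L0C stone_space" "w \<in> L0C stone_space"
  shows "supp z \<le> supp w \<longleftrightarrow> (\<forall>e. vanishes w e \<longrightarrow> vanishes z e)"
proof -
  have "supp z \<le> supp w \<longleftrightarrow> - supp w \<le> - supp z" by simp
  also have "\<dots> \<longleftrightarrow> (\<forall>e. e \<le> - supp w \<longrightarrow> e \<le> - supp z)" using order_trans by blast
  finally show ?thesis unfolding vanishes_iff_supp[OF assms(1)] vanishes_iff_supp[OF assms(2)] .
qed

lemma supp_set_nonvanishing:
  fixes X :: "'b::{boolean_algebra,complete_lattice} set L0C set"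
  assumes X: "X \<subseteq> L0C stone_space" and f: "f \<noteq> bot" "f \<le> supp_set X"
  shows "\<exists>x\<in>X. \<exists>a. a \<noteq> bot \<and> a \<le> f \<and> (\<forall>q\<in>stone_clopen a. cval x q \<noteq> 0)"
proof (rule ccontr)
  assume no: "\<not> ?thesis"
  have "supp x \<le> - f" if "x \<in> X" for x
  proof -
    have xL: "x \<in> L0C stone_space" using X that by blast
    have "vanishes x f" using nonvanishing_clopen[OF gcont_cval[OF xL], of f] no that by blast
    then show ?thesis using vanishes_iff_supp[OF xL] by (metis compl_le_compl_iff double_compl)
  qed
  then have "supp_set X \<le> - f" unfolding supp_set_def by (intro Sup_least) auto
  then have "f \<le> - f" using f(2) by simp
  then show False using f(1) by (simp add: inf_shunt[symmetric])
qed

section \<open>Ideals of continuous functions\<close>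

lemma CC_ideal_L0C: "CC_ideal Q X \<Longrightarrow> x \<in> X \<Longrightarrow> x \<in> L0C Q"
  using CC_E(1) unfolding CC_ideal_def by blast

text \<open>Below an element where some member \<open>a\<close> of the ideal has no zero, the ideal contains everything: the
  quotient \<open>f / a\<close>, cut off outside the clopen set, is continuous and multiplies \<open>a\<close> to \<open>f\<close>.\<close>

lemma ideal_contains_localized:
  fixes X :: "'b::{boolean_algebra,complete_lattice} set L0C set"
  assumes X: "CC_ideal stone_space X" and a: "a \<in> X" "\<forall>q\<in>stone_clopen e. cval a q \<noteq> 0"
    and f: "\<forall>q\<in>topspace stone_space. cont_at stone_space f q"
  shows "\<exists>u\<in>X. \<forall>\<^sub>F q in generic stone_space. cval u q = (if q \<in> stone_clopen e then f q else 0)"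
proof -
  have aCC: "a \<in> CC stone_space" using X a(1) unfolding CC_ideal_def by blast
  define k where "k q = (if q \<in> stone_clopen e then f q / cval a q else 0)" for q
  have "cont_at stone_space k q" if q: "q \<in> topspace stone_space" for q
  proof (cases "q \<in> stone_clopen e")
    case True
    have "cont_at stone_space (\<lambda>q. f q / cval a q) q"
      using f q a(2) True CC_E(2)[OF aCC q] by (intro tendsto_divide) auto
    moreover have "cont_at stone_space k q \<longleftrightarrow> cont_at stone_space (\<lambda>q. f q / cval a q) q"
      by (rule cont_at_cong_open[OF openin_stone_clopen True]) (simp add: k_def)
    ultimately show ?thesis by simp
  next
    case False
    then have qe: "q \<in> stone_clopen (- e)" using q by (simp add: stone_clopen_compl)
    have "k p = 0" if "p \<in> stone_clopen (- e)" for p using that by (simp add: k_def stone_clopen_compl)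
    then have "cont_at stone_space k q \<longleftrightarrow> cont_at stone_space (\<lambda>_. 0 :: complex) q"
      by (rule cont_at_cong_open[OF openin_stone_clopen qe])
    then show ?thesis by simp
  qed
  then have k: "\<forall>q\<in>topspace stone_space. cont_at stone_space k q" by blast
  define u where "u = L0C_mult stone_space (CC_embed stone_space k) a"
  have "u \<in> X" using X a(1) CC_embed_spec(1)[OF k] unfolding CC_ideal_def u_def by blast
  moreover have "\<forall>\<^sub>F q in generic stone_space. cval u q = (if q \<in> stone_clopen e then f q else 0)"
    using L0C_mult_spec(2)[OF CC_embed_spec(2)[OF k] CC_E(1)[OF aCC]] eventually_generic_topspace
  proof eventually_elim
    case (elim q)
    then show ?case using a(2) CC_embed_spec(3)[OF k elim(2)] by (simp add: u_def k_def)
  qed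
  ultimately show ?thesis by blast
qed

section \<open>\<open>\<sigma>\<close>-distributivity and locally constant functions\<close>

lemma constant_if_rationals_decided:
  fixes h :: "'a \<Rightarrow> real"
  assumes "\<And>r::rat. (\<forall>q\<in>A. h q \<le> of_rat r) \<or> (\<forall>q\<in>A. of_rat r \<le> h q)" "p \<in> A" "q \<in> A"
  shows "h p = h q"
proof -
  have "\<not> h x < h y" if "x \<in> A" "y \<in> A" for x y
  proof
    assume "h x < h y"
    then obtain r where "h x < of_rat r" "of_rat r < h y" using of_rat_dense by blast
    then show False using assms(1)[of r] that by force
  qed
  then show ?thesis using assms(2,3) by (meson linorder_less_linear)
qed

text \<open>The distributive law for the partitions \<open>{B n, - B n}\<close>: if no nonzero \<open>e\<close> below \<open>f\<close>
  decided all of them, then \<open>f\<close> would lie below the join of every choice of one member from each, hence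
  below the meet of these joins; by the law this meet is zero, as the two members of each are disjoint.\<close>

lemma sigma_distributive_decides:
  fixes B :: "nat \<Rightarrow> 'b::{boolean_algebra,complete_lattice}"
  assumes s: "sigma_distributive_below s" and f: "f \<noteq> bot" "f \<le> s"
  shows "\<exists>e. e \<noteq> bot \<and> e \<le> f \<and> (\<forall>n. e \<le> B n \<or> e \<le> - B n)"
proof -
  define E :: "nat \<Rightarrow> nat \<Rightarrow> 'b" where "E n m = inf s (if m = 0 then B n else - B n)" for n m
  have "(INF m. E n m) = bot" for n
  proof -
    have "(INF m. E n m) \<le> E n 0" "(INF m. E n m) \<le> E n 1" by (rule INF_lower; simp)+
    then have "(INF m. E n m) \<le> B n" "(INF m. E n m) \<le> - B n" unfolding E_def by simp_all
    then have "(INF m. E n m) \<le> inf (B n) (- B n)" by (rule inf_greatest)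
    then show ?thesis unfolding inf_compl_bot by (rule bot_unique[THEN iffD1])
  qed
  then have "(SUP n. INF m. E n m) = bot" by simp
  moreover have "(SUP n. INF m. E n m) = (INF \<phi>. SUP n. E n (\<phi> n))"
    using s unfolding sigma_distributive_below_def by (simp add: E_def)
  ultimately have "(INF \<phi>. SUP n. E n (\<phi> n)) = bot" by simp
  then have "\<not> f \<le> (INF \<phi>. SUP n. E n (\<phi> n))" using f(1) by (simp add: bot_unique)
  then obtain \<phi> where \<phi>: "\<not> f \<le> (SUP n. E n (\<phi> n))"
    using INF_greatest[of UNIV f "\<lambda>\<phi>. SUP n. E n (\<phi> n)"] by blast
  define e where "e = inf f (- (SUP n. E n (\<phi> n)))"
  have "e \<noteq> bot" using \<phi> unfolding e_def by (simp add: inf_shunt)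
  moreover have ef: "e \<le> f" unfolding e_def by simp
  moreover have "e \<le> B n \<or> e \<le> - B n" for n
  proof -
    have "E n (\<phi> n) \<le> (SUP n. E n (\<phi> n))" by (rule SUP_upper) simp
    then have "e \<le> - E n (\<phi> n)" unfolding e_def by (meson compl_mono inf_le2 order_trans)
    then have "inf e (E n (\<phi> n)) = bot" by (simp add: inf_shunt)
    moreover have "inf e s = e" using ef f(2) by (simp add: inf_absorb1)
    ultimately have "inf e (if \<phi> n = 0 then B n else - B n) = bot"
      unfolding E_def by (metis inf_assoc)
    then show ?thesis by (auto simp: inf_shunt split: if_splits)
  qed
  ultimately show ?thesis by blast
qed

text \<open>Apply the preceding lemma to the countably many elements that separate \<open>Re g\<close> and \<open>Im g\<close> at rational
  levels; a function for which every rational comparison is decided on a set is constant there.\<close>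

lemma sigma_distributive_locally_constant:
  fixes g :: "'b::{boolean_algebra,complete_lattice} set \<Rightarrow> complex"
  assumes s: "sigma_distributive_below s" and f: "f \<noteq> bot" "f \<le> s"
    and g: "\<forall>q\<in>topspace stone_space. cont_at stone_space g q"
  shows "\<exists>e c. e \<noteq> bot \<and> e \<le> f \<and> (\<forall>q\<in>stone_clopen e. g q = c)"
proof -
  define h where "h b q = (if b then Re (g q) else Im (g q))" for b q
  have hc: "\<forall>q\<in>topspace stone_space. cont_at stone_space (h b) q" for b
    using g unfolding h_def by (cases b) (auto intro!: tendsto_intros)
  have "\<exists>B. (\<forall>p\<in>stone_clopen B. h b p \<le> of_rat r) \<and> (\<forall>p\<in>stone_clopen (- B). of_rat r \<le> h b p)" for b and r :: rat
  proof -
    have "stone_clopen c \<inter> topspace stone_space = stone_clopen c" for c :: 'b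
      using stone_clopen_subset by blast
    then show ?thesis using clopen_threshold[OF dense_open_topspace hc[of b], of "of_rat r"] by simp
  qed
  then obtain B where B: "\<And>b r p. p \<in> stone_clopen (B b r) \<Longrightarrow> h b p \<le> of_rat r"
    "\<And>b r p. p \<in> stone_clopen (- B b r) \<Longrightarrow> of_rat r \<le> h b p" by metis
  obtain e where e: "e \<noteq> bot" "e \<le> f"
    "\<And>n. e \<le> (case from_nat n of (b, r) \<Rightarrow> B b r) \<or> e \<le> - (case from_nat n of (b, r) \<Rightarrow> B b r)"
    using sigma_distributive_decides[OF s f, of "\<lambda>n. case from_nat n of (b, r) \<Rightarrow> B b r"] by blast
  have "(\<forall>q\<in>stone_clopen e. h b q \<le> of_rat r) \<or> (\<forall>q\<in>stone_clopen e. of_rat r \<le> h b q)" for b r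
  proof -
    have "e \<le> B b r \<or> e \<le> - B b r" using e(3)[of "to_nat (b, r)"] by simp
    then show ?thesis using B stone_clopen_mono by blast
  qed
  then have const: "h b p = h b q" if "p \<in> stone_clopen e" "q \<in> stone_clopen e" for b p q
    using that by (rule constant_if_rationals_decided)
  obtain p where "p \<in> stone_clopen e" using e(1) stone_clopen_empty_iff by blast
  then have "g q = g p" if "q \<in> stone_clopen e" for q
    using const[of q p True] const[of q p False] that by (simp add: h_def complex_eq_iff)
  then show ?thesis using e by blast
qed

text \<open>Base three leaves a gap: the tail after position \<open>N\<close> is at most half of \<open>1 / 3 ^ N\<close>, so the first
  nonzero digit of a difference cannot be cancelled.\<close>

lemma ternary_tail_bound:
  fixes d :: "nat \<Rightarrow> real"
  assumes d: "\<And>k. \<bar>d k\<bar> \<le> 1"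
  shows "summable (\<lambda>k. d k / 3 ^ k)"
    and "(\<And>k. k < N \<Longrightarrow> d k = 0) \<Longrightarrow> \<bar>\<Sum>k. d k / 3 ^ k\<bar> \<le> (3/2) / 3 ^ N"
proof -
  have geo: "(\<lambda>k. 1 / 3 ^ (k + N) :: real) sums ((3/2) / 3 ^ N)" for N
    using sums_divide[OF geometric_sums[of "1/3::real"], of "3 ^ N"]
    by (simp add: power_add power_one_over field_simps)
  have le: "norm (d k / 3 ^ k) \<le> 1 / 3 ^ k" for k
    using d[of k] by (simp add: divide_right_mono)
  have "summable (\<lambda>k. 1 / 3 ^ k :: real)" using geo[of 0] by (simp add: sums_iff)
  then show sm: "summable (\<lambda>k. d k / 3 ^ k)" by (rule summable_comparison_test'[where N = 0]) (rule le)
  assume z: "\<And>k. k < N \<Longrightarrow> d k = 0"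
  have "(\<Sum>k. d k / 3 ^ k) = (\<Sum>k. d (k + N) / 3 ^ (k + N))"
    using suminf_split_initial_segment[OF sm, of N] z by simp
  moreover have "norm (\<Sum>k. d (k + N) / 3 ^ (k + N)) \<le> (\<Sum>k. 1 / 3 ^ (k + N))"
    using geo[of N] le[of "_ + N"] by (intro norm_suminf_le) (auto simp: sums_iff)
  ultimately show "\<bar>\<Sum>k. d k / 3 ^ k\<bar> \<le> (3/2) / 3 ^ N" using geo[of N] by (simp add: sums_iff)
qed

lemma ternary_injective:
  fixes d :: "nat \<Rightarrow> real"
  assumes d: "\<And>k. d k \<in> {-1, 0, 1}" and sum: "(\<Sum>k. d k / 3 ^ k) = 0"
  shows "d k = 0"
proof (rule ccontr)
  assume "d k \<noteq> 0"
  define N where "N = (LEAST k. d k \<noteq> 0)"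
  have N0: "d N \<noteq> 0" unfolding N_def using \<open>d k \<noteq> 0\<close> by (rule LeastI)
  have N: "d j = 0" if "j < N" for j using not_less_Least[of j "\<lambda>k. d k \<noteq> 0"] that unfolding N_def by blast
  have bd: "\<bar>d k\<bar> \<le> 1" for k using d[of k] by auto
  define d' where "d' k = (if k = N then 0 else d k)" for k
  have bd': "\<bar>d' k\<bar> \<le> 1" for k using bd[of k] unfolding d'_def by auto
  have "d' k = 0" if "k < Suc N" for k using that N unfolding d'_def by (auto simp: less_Suc_eq)
  then have "\<bar>\<Sum>k. d' k / 3 ^ k\<bar> \<le> (3/2) / 3 ^ Suc N" by (rule ternary_tail_bound(2)[OF bd'])
  moreover have "(\<lambda>k. d' k / 3 ^ k + (if k = N then d N / 3 ^ N else 0)) sums ((\<Sum>k. d' k / 3 ^ k) + d N / 3 ^ N)"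
    by (intro sums_add summable_sums ternary_tail_bound(1)[OF bd'] sums_single)
  moreover have "(\<lambda>k. d' k / 3 ^ k + (if k = N then d N / 3 ^ N else 0)) = (\<lambda>k. d k / 3 ^ k)"
    by (auto simp: d'_def)
  ultimately have "\<bar>d N\<bar> / 3 ^ N \<le> (3/2) / 3 ^ Suc N" using sum by (simp add: sums_iff abs_if split: if_splits)
  moreover have "\<bar>d N\<bar> = 1" using d[of N] N0 by auto
  ultimately show False by (simp add: field_simps)
qed

text \<open>The function \<open>g\<close> codes by ternary digits to which members of the double sequence a point belongs. If it
  were constant on a nonzero \<open>e\<close> below \<open>f\<close>, then \<open>e\<close> would be below or disjoint from each member. Since \<open>f\<close>
  avoids the left-hand side of the distributive law, every row contains a member disjoint from \<open>e\<close>; a function \<open>\<phi>\<close>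
  choosing them shows that \<open>e\<close> is disjoint from the right-hand side, which is above \<open>f\<close>.\<close>

lemma non_sigma_distributive_nowhere_constant:
  fixes s :: "'b::{boolean_algebra,complete_lattice}"
  assumes "\<not> sigma_distributive_below s"
  shows "\<exists>f g. f \<noteq> bot \<and> f \<le> s \<and> (\<forall>q\<in>topspace stone_space. cont_at stone_space (g :: 'b set \<Rightarrow> real) q) \<and>
    (\<forall>e c. e \<noteq> bot \<longrightarrow> e \<le> f \<longrightarrow> \<not> (\<forall>q\<in>stone_clopen e. g q = c))"
proof -
  obtain E :: "nat \<Rightarrow> nat \<Rightarrow> 'b" where E: "\<And>n m. E n m \<le> s"
    "(SUP n. INF m. E n m) \<noteq> (INF \<phi>. SUP n. E n (\<phi> n))"
    using assms unfolding sigma_distributive_below_def by blast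
  define l where "l = (SUP n. INF m. E n m)"
  define r where "r = (INF \<phi>. SUP n. E n (\<phi> n))"
  have "l \<le> r" unfolding l_def r_def
    by (intro SUP_least INF_greatest) (meson INF_lower SUP_upper UNIV_I order_trans)
  then have "\<not> r \<le> l" using E(2) unfolding l_def r_def by auto
  define f where "f = inf r (- l)"
  have f0: "f \<noteq> bot" using \<open>\<not> r \<le> l\<close> unfolding f_def by (simp add: inf_shunt)
  have "r \<le> (SUP n. E n ((\<lambda>_. 0) n))" unfolding r_def by (rule INF_lower) simp
  also have "\<dots> \<le> s" using E(1) by (intro SUP_least)
  finally have fs: "f \<le> s" unfolding f_def by (simp add: le_infI1)
  define a where "a k = (case prod_decode k of (n, m) \<Rightarrow> E n m)" for k
  define g :: "'b set \<Rightarrow> real" where "g q = (\<Sum>k. indicator (stone_clopen (a k)) q / 3 ^ k)" for q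
  define d :: "'b set \<Rightarrow> 'b set \<Rightarrow> nat \<Rightarrow> real"
    where "d p q k = indicator (stone_clopen (a k)) p - indicator (stone_clopen (a k)) q" for p q k
  have dv: "d p q k \<in> {-1, 0, 1}" for p q k unfolding d_def by (auto simp: indicator_def)
  then have db: "\<bar>d p q k\<bar> \<le> 1" for p q k unfolding d_def by (auto simp: indicator_def)
  have gd: "g p - g q = (\<Sum>k. d p q k / 3 ^ k)" for p q
  proof -
    have "summable (\<lambda>k. indicator (stone_clopen (a k)) q / 3 ^ k :: real)" for q
      by (rule ternary_tail_bound(1)) (auto simp: indicator_def)
    then show ?thesis unfolding g_def d_def by (subst suminf_diff) (auto simp: diff_divide_distrib)
  qed
  have "cont_at stone_space g q" if q: "q \<in> topspace stone_space" for q
  proof (rule tendstoI)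
    fix e :: real assume e: "0 < e"
    obtain N where N: "(1/3) ^ N < e / 2" using real_arch_pow_inv[of "e/2" "1/3::real"] e by auto
    have "\<forall>\<^sub>F p in nhdsin stone_space q. d p q k = 0" for k
    proof -
      define c where "c = (if q \<in> stone_clopen (a k) then a k else - a k)"
      have "q \<in> stone_clopen c" using q by (auto simp: c_def stone_clopen_compl)
      moreover have "\<forall>p\<in>stone_clopen c. d p q k = 0"
        by (auto simp: c_def d_def stone_clopen_compl indicator_def split: if_splits)
      ultimately show ?thesis unfolding eventually_nhdsin using openin_stone_clopen by blast
    qed
    then have "\<forall>\<^sub>F p in nhdsin stone_space q. \<forall>k\<in>{..<N}. d p q k = 0"
      by (intro eventually_ball_finite) auto
    then show "\<forall>\<^sub>F p in nhdsin stone_space q. dist (g p) (g q) < e"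
    proof (rule eventually_mono)
      fix p assume "\<forall>k\<in>{..<N}. d p q k = 0"
      then have "\<bar>g p - g q\<bar> \<le> (3/2) / 3 ^ N"
        unfolding gd by (intro ternary_tail_bound(2) db) auto
      also have "\<dots> < e" using N e by (simp add: power_one_over field_simps)
      finally show "dist (g p) (g q) < e" by (simp add: dist_real_def)
    qed
  qed
  moreover have "\<not> (\<forall>q\<in>stone_clopen e. g q = c)" if e: "e \<noteq> bot" "e \<le> f" for e c
  proof
    assume const: "\<forall>q\<in>stone_clopen e. g q = c"
    have dec: "e \<le> a k \<or> e \<le> - a k" for k
    proof (rule ccontr)
      assume no: "\<not> ?thesis"
      have "\<not> stone_clopen e \<subseteq> stone_clopen (a k)" "\<not> stone_clopen e \<subseteq> stone_clopen (- a k)"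
        using no by (simp_all only: stone_clopen_subset_iff de_Morgan_disj simp_thms)
      then obtain p q where pq: "p \<in> stone_clopen e" "p \<notin> stone_clopen (a k)"
        "q \<in> stone_clopen e" "q \<notin> stone_clopen (- a k)" by (meson subsetI)
      then have "(\<Sum>k. d p q k / 3 ^ k) = 0" using const gd[of p q] by simp
      then have "d p q k = 0" by (rule ternary_injective[OF dv])
      moreover have "q \<in> stone_clopen (a k)" using pq(3,4) stone_clopen_subset by (auto simp: stone_clopen_compl)
      ultimately show False using pq(2) by (simp add: d_def)
    qed
    have "\<exists>m. e \<le> - E n m" for n
    proof (rule ccontr)
      assume no: "\<not> ?thesis"
      have "e \<le> E n m" for m using dec[of "prod_encode (n, m)"] no by (auto simp: a_def)
      then have "e \<le> (INF m. E n m)" by (rule INF_greatest)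
      also have "\<dots> \<le> l" unfolding l_def by (rule SUP_upper) simp
      finally have "e \<le> l" .
      moreover have "e \<le> - l" using e(2) unfolding f_def by simp
      ultimately have "e \<le> inf l (- l)" by (rule inf_greatest)
      then show False using e(1) unfolding inf_compl_bot bot_unique by contradiction
    qed
    then obtain \<phi> where \<phi>: "\<And>n. e \<le> - E n (\<phi> n)" by metis
    have "E n (\<phi> n) \<le> - e" for n using \<phi>[of n] by (metis compl_le_compl_iff double_compl)
    then have "(SUP n. E n (\<phi> n)) \<le> - e" by (rule SUP_least)
    moreover have "r \<le> (SUP n. E n (\<phi> n))" unfolding r_def by (rule INF_lower) simp
    moreover have "e \<le> r" using e(2) unfolding f_def by simp
    ultimately have "e \<le> - e" by (meson order_trans)
    then show False using e(1) by (simp add: inf_shunt[symmetric])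
  qed
  ultimately have "f \<noteq> bot \<and> f \<le> s \<and> (\<forall>q\<in>topspace stone_space. cont_at stone_space g q) \<and>
    (\<forall>e c. e \<noteq> bot \<longrightarrow> e \<le> f \<longrightarrow> \<not> (\<forall>q\<in>stone_clopen e. g q = c))" using f0 fs by simp
  then show ?thesis by (intro exI)
qed

section \<open>Vanishing of derivations\<close>

text \<open>From \<open>u * u = u\<close> one gets \<open>\<delta> u = 2 * u * \<delta> u\<close>, and neither value of \<open>u\<close> admits a nonzero solution.\<close>

lemma derivation_idempotent_zero:
  fixes X :: "'b::{boolean_algebra,complete_lattice} set L0C set"
  assumes X: "X \<subseteq> L0C stone_space" and \<delta>: "derivation stone_space X \<delta>"
    and u: "u \<in> X" "\<forall>\<^sub>F q in generic stone_space. cval u q \<in> {0, 1}"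
  shows "\<forall>\<^sub>F q in generic stone_space. cval (\<delta> u) q = 0"
proof -
  have uL: "u \<in> L0C stone_space" and dL: "\<delta> u \<in> L0C stone_space"
    using X \<delta> u(1) unfolding derivation_def by auto
  have "L0C_mult stone_space u u = u"
  proof (rule L0C_eqI[OF L0C_mult_spec(1)[OF uL uL] uL])
    show "\<forall>\<^sub>F q in generic stone_space. cval (L0C_mult stone_space u u) q = cval u q"
      using L0C_mult_spec(2)[OF uL uL] u(2) by eventually_elim auto
  qed
  then have eq: "\<delta> u = L0C_add stone_space (L0C_mult stone_space (\<delta> u) u) (L0C_mult stone_space u (\<delta> u))"
    using \<delta> u(1) unfolding derivation_def by metis
  note m = L0C_mult_spec[OF dL uL] L0C_mult_spec[OF uL dL]
  show ?thesis
    using L0C_add_spec(2)[OF m(1) m(3), folded eq] m(2,4) u(2)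
    by eventually_elim auto
qed

text \<open>If \<open>\<delta> x\<close> were nonzero, one could find a nonzero \<open>e\<close> with \<open>\<delta> x\<close> without zeros on it, on which \<open>x\<close> is a
  constant \<open>c\<close> and whose idempotent \<open>u\<close> lies in \<open>X\<close>. Then \<open>x - c u\<close> vanishes on \<open>e\<close>, hence so does its
  image \<open>\<delta> x - c \<delta> u\<close>, and \<open>\<delta> u = 0\<close>.\<close>

lemma band_preserving_derivation_zero:
  fixes X :: "'b::{boolean_algebra,complete_lattice} set L0C set"
  assumes X: "CC_ideal stone_space X" and s: "sigma_distributive_below (supp_set X)"
    and \<delta>: "derivation stone_space X \<delta>" "band_preserving X \<delta>" and x: "x \<in> X"
  shows "\<delta> x = L0C_zero stone_space"
proof (rule ccontr)
  assume nz: "\<delta> x \<noteq> L0C_zero stone_space"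
  have XL: "X \<subseteq> L0C stone_space" using CC_ideal_L0C[OF X] by blast
  have dL: "\<delta> y \<in> L0C stone_space" if "y \<in> X" for y using \<delta>(1) that unfolding derivation_def by auto
  have "\<not> vanishes (\<delta> x) top"
  proof
    assume "vanishes (\<delta> x) top"
    then have "\<forall>\<^sub>F q in generic stone_space. cval (\<delta> x) q = cval (L0C_zero stone_space) q"
      unfolding vanishes_def using L0C_zero_spec(2) eventually_generic_topspace
      by eventually_elim simp
    then show False using nz L0C_eqI[OF dL[OF x] L0C_zero_spec(1)] by blast
  qed
  then obtain f where f: "f \<noteq> bot" "\<forall>q\<in>stone_clopen f. cval (\<delta> x) q \<noteq> 0"
    using nonvanishing_clopen[OF gcont_cval[OF dL[OF x]]] by blast
  have "vanishes (\<delta> x) (inf f (- supp (\<delta> x)))"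
    unfolding vanishes_iff_supp[OF dL[OF x]] by simp
  moreover have "\<forall>q\<in>stone_clopen (inf f (- supp (\<delta> x))). cval (\<delta> x) q \<noteq> 0"
    using f(2) by (simp add: stone_clopen_inf)
  ultimately have "inf f (- supp (\<delta> x)) = bot" by (rule vanishes_nonzero_bot)
  then have "f \<le> supp (\<delta> x)" by (simp add: inf_shunt)
  also have "\<dots> \<le> supp x" using \<delta>(2) x unfolding band_preserving_def by blast
  also have "\<dots> \<le> supp_set X" unfolding supp_set_def using x by (intro Sup_upper) simp
  finally have fs: "f \<le> supp_set X" .
  have "x \<in> CC stone_space" using X x unfolding CC_ideal_def by blast
  then have "\<forall>q\<in>topspace stone_space. cont_at stone_space (cval x) q" using CC_E(2)[of x stone_space] by simp
  then obtain e c where e: "e \<noteq> bot" "e \<le> f" "\<forall>q\<in>stone_clopen e. cval x q = c"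
    using sigma_distributive_locally_constant[OF s f(1) fs, of "cval x"] by blast
  have "e \<le> supp_set X" using e(2) fs by simp
  then obtain a e' where a: "a \<in> X" and e': "e' \<noteq> bot" "e' \<le> e" "\<forall>q\<in>stone_clopen e'. cval a q \<noteq> 0"
    using supp_set_nonvanishing[OF XL e(1)] by blast
  have "\<forall>q\<in>topspace stone_space. cont_at stone_space (\<lambda>_. 1 :: complex) (q :: 'b set)" by simp
  from ideal_contains_localized[OF X a e'(3) this]
  obtain u where u: "u \<in> X" "\<forall>\<^sub>F q in generic stone_space. cval u q = (if q \<in> stone_clopen e' then 1 else 0)"
    by blast
  define v where "v = L0C_scale stone_space (- c) u"
  define w where "w = L0C_add stone_space x v"
  have v: "v \<in> X" and w: "w \<in> X" using X u(1) x unfolding v_def w_def CC_ideal_def by blast+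
  have in_L: "u \<in> L0C stone_space" "v \<in> L0C stone_space" "w \<in> L0C stone_space" "x \<in> L0C stone_space"
    using XL u(1) v w x by auto
  have e'_const: "cval x q = c" if "q \<in> stone_clopen e'" for q
    using that e(3) e'(2) stone_clopen_mono by blast
  have "vanishes w e'"
    unfolding vanishes_def
    using L0C_add_spec(2)[OF in_L(4,2), folded w_def] L0C_scale_spec(2)[OF in_L(1), of "- c", folded v_def] u(2)
    by eventually_elim (simp add: e'_const)
  moreover have "supp (\<delta> w) \<le> supp w" using \<delta>(2) w unfolding band_preserving_def by blast
  ultimately have dw: "vanishes (\<delta> w) e'" using supp_le_iff[OF dL[OF w] in_L(3)] by blast
  have "\<forall>\<^sub>F q in generic stone_space. cval u q \<in> {0, 1}" using u(2) by (rule eventually_mono) simp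
  note du = derivation_idempotent_zero[OF XL \<delta>(1) u(1) this]
  have dv: "\<delta> v = L0C_scale stone_space (- c) (\<delta> u)" and dw': "\<delta> w = L0C_add stone_space (\<delta> x) (\<delta> v)"
    using \<delta>(1) u(1) v x unfolding derivation_def v_def w_def by blast+
  have "vanishes (\<delta> x) e'"
    using dw L0C_add_spec(2)[OF dL[OF x] dL[OF v], folded dw'] L0C_scale_spec(2)[OF dL[OF u(1)], of "- c", folded dv] du
    unfolding vanishes_def by eventually_elim simp
  moreover have "\<forall>q\<in>stone_clopen e'. cval (\<delta> x) q \<noteq> 0"
    using f(2) e(2) e'(2) stone_clopen_mono by blast
  ultimately show False using vanishes_nonzero_bot e'(1) by blast
qed

section \<open>A nonzero derivation\<close>

text \<open>A function that is nowhere constant on \<open>f\<close> is transcendental over the complex numbers there: a nonzero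
  polynomial has finitely many roots, and a continuous function with values among them is locally constant.
  Hence the formal derivative \<open>p(g) \<mapsto> p'(g)\<close> is local on \<open>f\<close>; it is set to zero elsewhere.\<close>

lemma nowhere_constant_local_derivation:
  fixes g :: "'b::{boolean_algebra,complete_lattice} set \<Rightarrow> complex"
  assumes g: "\<forall>q\<in>topspace stone_space. cont_at stone_space g q"
    and nc: "\<And>e c. e \<noteq> bot \<Longrightarrow> e \<le> f \<Longrightarrow> \<not> (\<forall>q\<in>stone_clopen e. g q = c)"
  shows "local_derivation stone_space
    (range (\<lambda>p. (\<lambda>q. poly p (g q), \<lambda>q. indicator (stone_clopen f) q * poly (pderiv p) (g q))))"
    (is "local_derivation ?Q ?M")
proof -
  have gg: "gcont ?Q g" using g by (intro gcont_continuous_map) (simp add: continuous_map_iff_cont_at)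
  have gp: "gcont ?Q (\<lambda>q. poly p (g q))" for p
    by (rule gcont_continuous_compose[OF gg]) (intro continuous_intros)
  have loc: "\<forall>\<^sub>F q in generic ?Q. poly p (g q) = 0 \<longrightarrow> indicator (stone_clopen f) q * poly (pderiv p) (g q) = 0" for p
  proof (cases "p = 0")
    case False
    show ?thesis
      unfolding eventually_generic_local
    proof (intro allI impI)
      fix U :: "'b set set" assume U: "openin ?Q U" "U \<noteq> {}"
      let ?goal = "\<lambda>V. openin ?Q V \<and> V \<noteq> {} \<and> V \<subseteq> U \<and>
        (\<forall>q\<in>V. poly p (g q) = 0 \<longrightarrow> indicator (stone_clopen f) q * poly (pderiv p) (g q) = 0)"
      show "\<exists>V. ?goal V"
      proof (cases "U \<inter> stone_clopen f = {}")
        case True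
        then have "?goal U" using U by (auto simp: indicator_def)
        then show ?thesis by (rule exI)
      next
        case ne: False
        have "openin ?Q (U \<inter> stone_clopen f)" using U by auto
        with gp[of p] obtain V where V: "openin ?Q V" "V \<noteq> {}" "V \<subseteq> U \<inter> stone_clopen f"
          "(\<forall>q\<in>V. poly p (g q) = 0) \<or> (\<forall>q\<in>V. poly p (g q) \<noteq> 0)"
          using ne by (rule gcont_zero_or_nonzero)
        have "\<not> (\<forall>q\<in>V. poly p (g q) = 0)"
        proof
          assume roots: "\<forall>q\<in>V. poly p (g q) = 0"
          obtain q where q: "q \<in> V" using V(2) by blast
          then have qt: "q \<in> topspace ?Q" using V(1) openin_subset by blast
          \<comment> \<open>Removing the other roots leaves an open set in which \<open>g q\<close> is the only root.\<close>
          define W where "W = - ({z. poly p z = 0} - {g q})"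
          have "finite {z. poly p z = 0}" using False by (rule poly_roots_finite)
          then have "open W" unfolding W_def by (intro open_Compl finite_imp_closed) auto
          moreover have "g q \<in> W" unfolding W_def by simp
          ultimately obtain a where a: "q \<in> stone_clopen a" "\<forall>r\<in>stone_clopen a. g r \<in> W"
            using stone_cont_at_nbhd[OF g[rule_format, OF qt] qt] by blast
          obtain b where b: "q \<in> stone_clopen b" "stone_clopen b \<subseteq> V"
            using openin_stone_contains_clopen[OF V(1) q] by blast
          have ne_bot: "inf a b \<noteq> bot" using a(1) b(1) stone_clopen_inf[of a b] stone_clopen_bot by (metis IntI empty_iff)
          have "stone_clopen b \<subseteq> stone_clopen f" using b(2) V(3) by blast
          then have "inf a b \<le> f" by (simp add: stone_clopen_subset_iff le_infI2)
          moreover have "\<forall>r\<in>stone_clopen (inf a b). g r = g q"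
            using a(2) b(2) roots unfolding W_def stone_clopen_inf by blast
          ultimately show False using nc ne_bot by blast
        qed
        then have "\<forall>q\<in>V. poly p (g q) \<noteq> 0" using V(4) by argo
        then have "?goal V" using V(1-3) by simp
        then show ?thesis by (rule exI)
      qed
    qed
  qed simp
  have inM: "(u, v) \<in> ?M" if "u = (\<lambda>q. poly p (g q))" "v = (\<lambda>q. indicator (stone_clopen f) q * poly (pderiv p) (g q))" for u v p
    using that by blast
  show ?thesis
    unfolding local_derivation_def
  proof (intro conjI ballI allI case_prodI2)
    fix m u v assume "m \<in> ?M" "m = (u, v)"
    then obtain p where p: "u = (\<lambda>q. poly p (g q))" "v = (\<lambda>q. indicator (stone_clopen f) q * poly (pderiv p) (g q))"
      by blast
    show "gcont ?Q u" unfolding p by (rule gp)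
    show "gcont ?Q v" unfolding p by (intro gcont_mult gp gcont_indicator openin_stone_clopen)
    show "\<forall>\<^sub>F q in generic ?Q. u q = 0 \<longrightarrow> v q = 0" unfolding p by (rule loc)
    fix m' u' v' assume "m' \<in> ?M" "m' = (u', v')"
    then obtain p' where p': "u' = (\<lambda>q. poly p' (g q))" "v' = (\<lambda>q. indicator (stone_clopen f) q * poly (pderiv p') (g q))"
      by blast
    show "(\<lambda>q. u q + u' q, \<lambda>q. v q + v' q) \<in> ?M"
      by (rule inM[where p = "p + p'"]) (auto simp: p p' pderiv_add algebra_simps)
    show "(\<lambda>q. u q * u' q, \<lambda>q. u q * v' q + v q * u' q) \<in> ?M"
      by (rule inM[where p = "p * p'"]) (auto simp: p p' pderiv_mult algebra_simps)
  next
    fix c :: complex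
    show "(\<lambda>_. c, \<lambda>_. 0) \<in> ?M" by (rule inM[where p = "[:c:]"]) (auto simp: pderiv_pCons)
  qed
qed

lemma local_derivation_unique:
  assumes M: "local_derivation Q M" "(u, v) \<in> M" "(u', v') \<in> M"
    and eq: "\<forall>\<^sub>F q in generic Q. q \<in> A \<longrightarrow> u q = u' q"
  shows "\<forall>\<^sub>F q in generic Q. q \<in> A \<longrightarrow> v q = v' q"
  using local_derivationD(3)[OF M(1) local_derivation_diff[OF M]] eq
  by eventually_elim simp

text \<open>Extend the derivation that differentiates with respect to \<open>g\<close> to all generically continuous functions and
  restrict it to \<open>X\<close>. Locality makes it band preserving. It is nonzero because \<open>X\<close> contains \<open>g\<close> cut off to a
  nonzero \<open>e\<close> below \<open>f\<close>, and the derivative of that function is one on \<open>e\<close>.\<close>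

lemma nonzero_derivation_exists:
  fixes X :: "'b::{boolean_algebra,complete_lattice} set L0C set"
  assumes X: "CC_ideal stone_space X" and ns: "\<not> sigma_distributive_below (supp_set X)"
  shows "\<exists>\<delta>. derivation stone_space X \<delta> \<and> band_preserving X \<delta> \<and> (\<exists>x\<in>X. \<delta> x \<noteq> L0C_zero stone_space)"
proof -
  let ?Q = "stone_space :: 'b set topology"
  have XL: "X \<subseteq> L0C ?Q" using CC_ideal_L0C[OF X] by blast
  obtain f and g0 :: "'b set \<Rightarrow> real" where f: "f \<noteq> bot" "f \<le> supp_set X"
    and g0: "\<forall>q\<in>topspace ?Q. cont_at ?Q g0 q"
    and nc: "\<forall>e c. e \<noteq> bot \<longrightarrow> e \<le> f \<longrightarrow> \<not> (\<forall>q\<in>stone_clopen e. g0 q = c)"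
    using non_sigma_distributive_nowhere_constant[OF ns] by blast
  define g where "g q = complex_of_real (g0 q)" for q
  have g: "\<forall>q\<in>topspace ?Q. cont_at ?Q g q" using g0 unfolding g_def by (auto intro!: tendsto_intros)
  have "\<not> (\<forall>q\<in>stone_clopen e. g q = c)" if "e \<noteq> bot" "e \<le> f" for e c
  proof
    assume "\<forall>q\<in>stone_clopen e. g q = c"
    then have "\<forall>q\<in>stone_clopen e. g0 q = Re c" unfolding g_def by auto
    then show False using nc that by blast
  qed
  from local_derivation_extends[OF nowhere_constant_local_derivation[OF g this]]
  obtain M where M: "local_derivation ?Q M"
    "range (\<lambda>p. (\<lambda>q. poly p (g q), \<lambda>q. indicator (stone_clopen f) q * poly (pderiv p) (g q))) \<subseteq> M"
    "\<forall>x. gcont ?Q x \<longrightarrow> (\<exists>y. (x, y) \<in> M)" by blast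
  have "(\<lambda>q. poly [:0, 1:] (g q), \<lambda>q. indicator (stone_clopen f) q * poly (pderiv [:0, 1:]) (g q)) \<in> M"
    using M(2) by blast
  then have gM: "(g, indicator (stone_clopen f)) \<in> M" by (simp add: pderiv_pCons)
  have "\<forall>x\<in>L0C ?Q. \<exists>p. fst p \<in> L0C ?Q \<and> (cval x, snd p) \<in> M \<and>
      (\<forall>\<^sub>F q in generic ?Q. cval (fst p) q = snd p q)"
  proof
    fix x assume x: "x \<in> L0C ?Q"
    obtain v where v: "(cval x, v) \<in> M" using M(3)[rule_format, OF gcont_cval[OF x]] by (rule exE)
    obtain z where "z \<in> L0C ?Q" "\<forall>\<^sub>F q in generic ?Q. cval z q = v q"
      using L0C_of_gcont[OF local_derivationD(2)[OF M(1) v]] by (rule bexE)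
    then show "\<exists>p. fst p \<in> L0C ?Q \<and> (cval x, snd p) \<in> M \<and> (\<forall>\<^sub>F q in generic ?Q. cval (fst p) q = snd p q)"
      using v by (intro exI[of _ "(z, v)"]) simp
  qed
  from bchoice[OF this] obtain F where F: "\<forall>x\<in>L0C ?Q. fst (F x) \<in> L0C ?Q \<and> (cval x, snd (F x)) \<in> M \<and>
      (\<forall>\<^sub>F q in generic ?Q. cval (fst (F x)) q = snd (F x) q)" by (rule exE)
  define \<delta> where "\<delta> x = fst (F x)" for x
  define V where "V x = snd (F x)" for x
  have \<delta>: "\<delta> x \<in> L0C ?Q" "(cval x, V x) \<in> M" "\<forall>\<^sub>F q in generic ?Q. cval (\<delta> x) q = V x q"
    if "x \<in> L0C ?Q" for x using F that unfolding \<delta>_def V_def by simp_all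
  have key: "\<forall>\<^sub>F q in generic ?Q. q \<in> A \<longrightarrow> cval (\<delta> x) q = v q"
    if x: "x \<in> L0C ?Q" and uv: "(u, v) \<in> M" and eq: "\<forall>\<^sub>F q in generic ?Q. q \<in> A \<longrightarrow> cval x q = u q" for x u v A
    using local_derivation_unique[OF M(1) \<delta>(2)[OF x] uv eq] \<delta>(3)[OF x] by eventually_elim simp
  have \<delta>_eqI: "\<delta> x = y"
    if x: "x \<in> L0C ?Q" and y: "y \<in> L0C ?Q" and uv: "(u, v) \<in> M"
      and eq: "\<forall>\<^sub>F q in generic ?Q. cval x q = u q" "\<forall>\<^sub>F q in generic ?Q. cval y q = v q" for x y u v
    using key[OF x uv, of UNIV] eq \<delta>(1)[OF x] y by (intro L0C_eqI) (auto elim: eventually_elim2)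
  have "derivation ?Q X \<delta>"
    unfolding derivation_def
  proof (intro conjI ballI allI)
    show "\<delta> \<in> X \<rightarrow> L0C ?Q" using \<delta>(1) XL by blast
    fix x assume "x \<in> X"
    then have x: "x \<in> L0C ?Q" using XL by blast
    show "\<delta> (L0C_scale ?Q c x) = L0C_scale ?Q c (\<delta> x)" for c
    proof (rule \<delta>_eqI[OF L0C_scale_spec(1)[OF x] L0C_scale_spec(1)[OF \<delta>(1)[OF x]]
          local_derivation_cmult[OF M(1) \<delta>(2)[OF x]] L0C_scale_spec(2)[OF x]])
      show "\<forall>\<^sub>F q in generic ?Q. cval (L0C_scale ?Q c (\<delta> x)) q = c * V x q"
        using L0C_scale_spec(2)[OF \<delta>(1)[OF x]] \<delta>(3)[OF x] by eventually_elim simp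
    qed
    fix y assume "y \<in> X"
    then have y: "y \<in> L0C ?Q" using XL by blast
    show "\<delta> (L0C_add ?Q x y) = L0C_add ?Q (\<delta> x) (\<delta> y)"
    proof (rule \<delta>_eqI[OF L0C_add_spec(1)[OF x y] L0C_add_spec(1)[OF \<delta>(1)[OF x] \<delta>(1)[OF y]]
          local_derivationD(5)[OF M(1) \<delta>(2)[OF x] \<delta>(2)[OF y]] L0C_add_spec(2)[OF x y]])
      show "\<forall>\<^sub>F q in generic ?Q. cval (L0C_add ?Q (\<delta> x) (\<delta> y)) q = V x q + V y q"
        using L0C_add_spec(2)[OF \<delta>(1)[OF x] \<delta>(1)[OF y]] \<delta>(3)[OF x] \<delta>(3)[OF y] by eventually_elim simp
    qed
    note m = L0C_mult_spec[OF \<delta>(1)[OF x] y] L0C_mult_spec[OF x \<delta>(1)[OF y]]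
    show "\<delta> (L0C_mult ?Q x y) = L0C_add ?Q (L0C_mult ?Q (\<delta> x) y) (L0C_mult ?Q x (\<delta> y))"
    proof (rule \<delta>_eqI[OF L0C_mult_spec(1)[OF x y] L0C_add_spec(1)[OF m(1,3)]
          local_derivationD(6)[OF M(1) \<delta>(2)[OF x] \<delta>(2)[OF y]] L0C_mult_spec(2)[OF x y]])
      show "\<forall>\<^sub>F q in generic ?Q. cval (L0C_add ?Q (L0C_mult ?Q (\<delta> x) y) (L0C_mult ?Q x (\<delta> y))) q =
          cval x q * V y q + V x q * cval y q"
        using L0C_add_spec(2)[OF m(1,3)] m(2,4) \<delta>(3)[OF x] \<delta>(3)[OF y] by eventually_elim simp
    qed
  qed
  moreover have "band_preserving X \<delta>"
    unfolding band_preserving_def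
  proof
    fix x assume "x \<in> X"
    then have x: "x \<in> L0C ?Q" using XL by blast
    show "supp (\<delta> x) \<le> supp x"
      unfolding supp_le_iff[OF \<delta>(1)[OF x] x] vanishes_def
      using key[OF x local_derivationD(4)[OF M(1), of 0]] by blast
  qed
  moreover have "\<exists>x\<in>X. \<delta> x \<noteq> L0C_zero ?Q"
  proof -
    obtain a e where a: "a \<in> X" and e: "e \<noteq> bot" "e \<le> f" "\<forall>q\<in>stone_clopen e. cval a q \<noteq> 0"
      using supp_set_nonvanishing[OF XL f] by blast
    obtain u where u: "u \<in> X" "\<forall>\<^sub>F q in generic ?Q. cval u q = (if q \<in> stone_clopen e then g q else 0)"
      using ideal_contains_localized[OF X a e(3) g] by blast
    have uL: "u \<in> L0C ?Q" using u(1) XL by blast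
    have "\<forall>\<^sub>F q in generic ?Q. q \<in> stone_clopen e \<longrightarrow> cval u q = g q"
      using u(2) by (rule eventually_mono) simp
    note 1 = key[OF uL gM this]
    have "\<delta> u \<noteq> L0C_zero ?Q"
    proof
      assume "\<delta> u = L0C_zero ?Q"
      then have "\<forall>\<^sub>F q in generic ?Q. cval (\<delta> u) q = 0" using L0C_zero_spec(2)[of ?Q] by simp
      with 1 have "\<forall>\<^sub>F q in generic ?Q. q \<notin> stone_clopen e"
      proof eventually_elim
        case (elim q)
        then show ?case using stone_clopen_mono[OF e(2)] by (auto simp: indicator_def split: if_splits)
      qed
      moreover have "stone_clopen e \<noteq> {}" using e(1) by simp
      ultimately show False
        using openin_stone_clopen[of e] eventually_generic_obtains[of "\<lambda>q. q \<notin> stone_clopen e" ?Q "stone_clopen e"]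
        by (metis equals0I subsetD)
    qed
    then show ?thesis using u(1) by blast
  qed
  ultimately show ?thesis by blast
qed

theorem theorem4p4:
  fixes X :: "'b::{boolean_algebra,complete_lattice} set L0C set"
  assumes "CC_ideal stone_space X"
  shows "sigma_distributive_below (supp_set X) \<longleftrightarrow>
    (\<forall>\<delta>. derivation stone_space X \<delta> \<and> band_preserving X \<delta> \<longrightarrow>
         (\<forall>x\<in>X. \<delta> x = L0C_zero stone_space))"
  using band_preserving_derivation_zero[OF assms] nonzero_derivation_exists[OF assms] by blast

end
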